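(* Let $\mathcal{L}$ be a complex $(n+1)$-dimensional non standard $3$-filiform non-Lie Leibniz algebra of maximum length whose associated naturally graded algebra $\mathrm{gr}\,\mathcal{L}$ is isomorphic to $KF_4\oplus\mathbb{C}$. Then $\mathcal{L}$ is isomorphic either to $M$ or to one of the algebras of the family $M^{1,\alpha}$, $\alpha\in\mathbb{C}$, where $M$ and $M^{1,\alpha}$ have basis $\{y_1,\dots,y_n,z_1\}$ and the following products (all products of basis elements not listed are zero): $$M:\quad [y_i,y_1]=y_{i+1}\ (1\le i\le n-3),\qquad [y_1,y_{n-1}]=y_n,\qquad [z_1,y_{n-1}]=y_{n-2};$$ $$M^{1,\alpha}:\quad [y_i,y_1]=y_{i+1}\ (1\le i\le n-3),\qquad [y_1,y_{n-1}]=y_n,\qquad [y_{n-1},z_1]=y_{n-2},\qquad [z_1,y_{n-1}]=\alpha y_{n-2}.$$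
   Context: All algebras are finite-dimensional over $\mathbb{C}$. A Leibniz algebra is a vector space $\mathcal{L}$ with a bilinear product $[\cdot,\cdot]$ satisfying $[x,[y,z]]=[[x,y],z]-[[x,z],y]$ for all $x,y,z$; it is non-Lie if it is not a Lie algebra. The descending central sequence is $\mathcal{L}^1=\mathcal{L}$, $\mathcal{L}^{k+1}=[\mathcal{L}^k,\mathcal{L}]$; $\mathcal{L}$ is nilpotent if $\mathcal{L}^{k}=0$ for some $k$. For nilpotent $\mathcal{L}$, put $\mathcal{L}_i=\mathcal{L}^i/\mathcal{L}^{i+1}$ and $\mathrm{gr}\,\mathcal{L}=\bigoplus_i\mathcal{L}_i$ with the induced product, $[\mathcal{L}_i,\mathcal{L}_j]\subseteq\mathcal{L}_{i+j}$; this is the associated naturally graded algebra. For $x\in\mathcal{L}$ let $R_x(y)=[y,x]$. For $\mathcal{L}$ nilpotent and $x\in\mathcal{L}\setminus\mathcal{L}^2$ let $C(x)$ be the decreasing sequence of the sizes of the Jordan blocks of the nilpotent operator $R_x$. The characteristic sequence $C(\mathcal{L})$ is the maximum of $C(x)$ over $x\in\mathcal{L}\setminus\mathcal{L}^2$ in the lexicographic order. A nilpotent Leibniz algebra of dimension $m$ is $3$-filiform if $C(\mathcal{L})=(m-3,1,1,1)$. A connected gradation of $\mathcal{L}$ is a vector space decomposition $\mathcal{L}=V_{k}\oplus V_{k+1}\oplus\dots\oplus V_{k+t}$, with $k\in\mathbb{Z}$, all $V_{k+i}\ne 0$ for $0\le i\le t$, and $[V_i,V_j]\subseteq V_{i+j}$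 for all $i,j\in\mathbb{Z}$ (where $V_i=0$ for indices outside $\{k,\dots,k+t\}$). Its length is $t+1$. The length $l(\mathcal{L})$ is the maximal length of a connected gradation of $\mathcal{L}$, and $\mathcal{L}$ is of maximum length if $l(\mathcal{L})=\dim\mathcal{L}$. An algebra $\mathcal{L}$ of maximum length is called standard if it is a direct sum $\mathcal{L}=N_1\oplus\dots\oplus N_k$ of $k\ge 2$ nonzero ideals each of which is an algebra of maximum length; otherwise it is called non standard. $KF_4$ is the $n$-dimensional naturally graded $2$-filiform Leibniz algebra (characteristic sequence $(n-2,1,1)$) with basis $\{e_1,\dots,e_n\}$ and nonzero products $[e_i,e_1]=e_{i+1}$ for $1\le i\le n-3$ and $[e_1,e_{n-1}]=e_n$. $KF_4\oplus\mathbb{C}$ is its direct sum with the one-dimensional algebra with zero product.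
   Formalization: The theorem is proved for n ≥ 4 with n ≠ 5 and n ≠ 6: KF_4 has characteristic sequence (n-2,1,1) only for n ≥ 4, and for n = 5 and n = 6 there are further non standard algebras satisfying all hypotheses, so the list M, M^{1,α} is incomplete there. *)

theory Defs
  imports Jordan_Normal_Form.Jordan_Normal_Form "HOL-Library.FuncSet"
begin

(* An algebra is a subspace L of an ambient complex vector space (scalar multiplication sc)
   together with a product br, of which only the values on L matter. Ideals are then algebras
   for the same sc and br. *)

definition fd_algebra ::
    "(complex \<Rightarrow> 'a::ab_group_add \<Rightarrow> 'a) \<Rightarrow> 'a set \<Rightarrow> ('a \<Rightarrow> 'a \<Rightarrow> 'a) \<Rightarrow> bool" where
  "fd_algebra sc L br \<longleftrightarrow>
     vector_space sc \<and> module.subspace sc L \<and> (\<exists>B. finite B \<and> module.span sc B = L) \<and>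
     (\<forall>x\<in>L. \<forall>y\<in>L. br x y \<in> L) \<and>
     (\<forall>x\<in>L. \<forall>y\<in>L. \<forall>z\<in>L. br (x + y) z = br x z + br y z \<and> br x (y + z) = br x y + br x z) \<and>
     (\<forall>c. \<forall>x\<in>L. \<forall>y\<in>L. br (sc c x) y = sc c (br x y) \<and> br x (sc c y) = sc c (br x y))"

definition leibniz_algebra ::
    "(complex \<Rightarrow> 'a::ab_group_add \<Rightarrow> 'a) \<Rightarrow> 'a set \<Rightarrow> ('a \<Rightarrow> 'a \<Rightarrow> 'a) \<Rightarrow> bool" where
  "leibniz_algebra sc L br \<longleftrightarrow>
     fd_algebra sc L br \<and>
     (\<forall>x\<in>L. \<forall>y\<in>L. \<forall>z\<in>L. br x (br y z) = br (br x y) z - br (br x z) y)"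

definition lie_algebra ::
    "(complex \<Rightarrow> 'a::ab_group_add \<Rightarrow> 'a) \<Rightarrow> 'a set \<Rightarrow> ('a \<Rightarrow> 'a \<Rightarrow> 'a) \<Rightarrow> bool" where
  "lie_algebra sc L br \<longleftrightarrow>
     fd_algebra sc L br \<and> (\<forall>x\<in>L. br x x = 0) \<and>
     (\<forall>x\<in>L. \<forall>y\<in>L. \<forall>z\<in>L. br x (br y z) + br y (br z x) + br z (br x y) = 0)"

(* L^k is lcs sc L br k for k \<ge> 1; the convention L^0 = L makes the degree 0 part of gr L zero. *)

fun lcs :: "(complex \<Rightarrow> 'a::ab_group_add \<Rightarrow> 'a) \<Rightarrow> 'a set \<Rightarrow> ('a \<Rightarrow> 'a \<Rightarrow> 'a) \<Rightarrow> nat \<Rightarrow> 'a set" where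
  "lcs sc L br 0 = L"
| "lcs sc L br (Suc 0) = L"
| "lcs sc L br (Suc (Suc k)) = module.span sc {br a b | a b. a \<in> lcs sc L br (Suc k) \<and> b \<in> L}"

definition nilpotent_algebra ::
    "(complex \<Rightarrow> 'a::ab_group_add \<Rightarrow> 'a) \<Rightarrow> 'a set \<Rightarrow> ('a \<Rightarrow> 'a \<Rightarrow> 'a) \<Rightarrow> bool" where
  "nilpotent_algebra sc L br \<longleftrightarrow> (\<exists>k\<ge>1. lcs sc L br k = {0})"

(* Algebras carrying their own vector space operations; needed because gr L consists of families
   of cosets. Isomorphism is defined at this level. *)

record 'v alg =
  alg_carrier :: "'v set"
  alg_add :: "'v \<Rightarrow> 'v \<Rightarrow> 'v"
  alg_scale :: "complex \<Rightarrow> 'v \<Rightarrow> 'v"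
  alg_prod :: "'v \<Rightarrow> 'v \<Rightarrow> 'v"

definition alg_isomorphic :: "'v alg \<Rightarrow> 'w alg \<Rightarrow> bool" where
  "alg_isomorphic A B \<longleftrightarrow>
     (\<exists>\<phi>. bij_betw \<phi> (alg_carrier A) (alg_carrier B) \<and>
       (\<forall>x\<in>alg_carrier A. \<forall>y\<in>alg_carrier A. \<phi> (alg_add A x y) = alg_add B (\<phi> x) (\<phi> y)) \<and>
       (\<forall>c. \<forall>x\<in>alg_carrier A. \<phi> (alg_scale A c x) = alg_scale B c (\<phi> x)) \<and>
       (\<forall>x\<in>alg_carrier A. \<forall>y\<in>alg_carrier A. \<phi> (alg_prod A x y) = alg_prod B (\<phi> x) (\<phi> y)))"

definition alg_of ::
    "(complex \<Rightarrow> 'a::ab_group_add \<Rightarrow> 'a) \<Rightarrow> 'a set \<Rightarrow> ('a \<Rightarrow> 'a \<Rightarrow> 'a) \<Rightarrow> 'a alg" where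
  "alg_of sc L br = \<lparr>alg_carrier = L, alg_add = (+), alg_scale = sc, alg_prod = br\<rparr>"

definition alg_direct_sum :: "'v alg \<Rightarrow> 'w alg \<Rightarrow> ('v \<times> 'w) alg" where
  "alg_direct_sum A B =
     \<lparr>alg_carrier = alg_carrier A \<times> alg_carrier B,
      alg_add = (\<lambda>(a, b) (a', b'). (alg_add A a a', alg_add B b b')),
      alg_scale = (\<lambda>c (a, b). (alg_scale A c a, alg_scale B c b)),
      alg_prod = (\<lambda>(a, b) (a', b'). (alg_prod A a a', alg_prod B b b'))\<rparr>"

definition lcs_quotient ::
    "(complex \<Rightarrow> 'a::ab_group_add \<Rightarrow> 'a) \<Rightarrow> 'a set \<Rightarrow> ('a \<Rightarrow> 'a \<Rightarrow> 'a) \<Rightarrow> nat \<Rightarrow> 'a set set" where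
  "lcs_quotient sc L br i = (\<lambda>a. (\<lambda>c. a + c) ` lcs sc L br (Suc i)) ` lcs sc L br i"

(* An element of gr L is a finitely supported family f of cosets f i in L^i / L^(i+1); the zero
   coset is L^(i+1) itself. The degree k part of a product is the coset of the sum over
   i + j = k of the products of representatives of f i and g j. *)

definition gr_alg ::
    "(complex \<Rightarrow> 'a::ab_group_add \<Rightarrow> 'a) \<Rightarrow> 'a set \<Rightarrow> ('a \<Rightarrow> 'a \<Rightarrow> 'a) \<Rightarrow> (nat \<Rightarrow> 'a set) alg" where
  "gr_alg sc L br =
     \<lparr>alg_carrier = {f. (\<forall>i. f i \<in> lcs_quotient sc L br i) \<and> finite {i. f i \<noteq> lcs sc L br (Suc i)}},
      alg_add = (\<lambda>f g i. {a + b | a b. a \<in> f i \<and> b \<in> g i}),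
      alg_scale = (\<lambda>c f i. {sc c a + b | a b. a \<in> f i \<and> b \<in> lcs sc L br (Suc i)}),
      alg_prod = (\<lambda>f g k. {(\<Sum>i\<le>k. br (a i) (b (k - i))) + c | a b c.
         (\<forall>i. a i \<in> f i) \<and> (\<forall>i. b i \<in> g i) \<and> c \<in> lcs sc L br (Suc k)})\<rparr>"

(* ns is C(x), the decreasing list of the sizes of the Jordan blocks of y \<mapsto> [y,x] on L. *)

definition has_block_sizes ::
    "(complex \<Rightarrow> 'a::ab_group_add \<Rightarrow> 'a) \<Rightarrow> 'a set \<Rightarrow> ('a \<Rightarrow> 'a \<Rightarrow> 'a) \<Rightarrow> 'a \<Rightarrow> nat list \<Rightarrow> bool" where
  "has_block_sizes sc L br x ns \<longleftrightarrow>
     (\<exists>bs n_as. distinct bs \<and> \<not> module.dependent sc (set bs) \<and> module.span sc (set bs) = L \<and>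
        jordan_nf (mat (length bs) (length bs)
          (\<lambda>(i, j). module.representation sc (set bs) (br (bs ! j) x) (bs ! i))) n_as \<and>
        ns = rev (sort (map fst n_as)))"

definition is_char_sequence ::
    "(complex \<Rightarrow> 'a::ab_group_add \<Rightarrow> 'a) \<Rightarrow> 'a set \<Rightarrow> ('a \<Rightarrow> 'a \<Rightarrow> 'a) \<Rightarrow> nat list \<Rightarrow> bool" where
  "is_char_sequence sc L br ns \<longleftrightarrow>
     (\<exists>x\<in>L - lcs sc L br 2. has_block_sizes sc L br x ns) \<and>
     (\<forall>x\<in>L - lcs sc L br 2. \<forall>ms. has_block_sizes sc L br x ms \<longrightarrow>
        ms = ns \<or> (ms, ns) \<in> lexord less_than)"

definition three_filiform ::
    "(complex \<Rightarrow> 'a::ab_group_add \<Rightarrow> 'a) \<Rightarrow> 'a set \<Rightarrow> ('a \<Rightarrow> 'a \<Rightarrow> 'a) \<Rightarrow> bool" where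
  "three_filiform sc L br \<longleftrightarrow>
     leibniz_algebra sc L br \<and> nilpotent_algebra sc L br \<and>
     is_char_sequence sc L br [vector_space.dim sc L - 3, 1, 1, 1]"

definition is_direct_sum ::
    "(complex \<Rightarrow> 'a::ab_group_add \<Rightarrow> 'a) \<Rightarrow> 'a set \<Rightarrow> 'i set \<Rightarrow> ('i \<Rightarrow> 'a set) \<Rightarrow> bool" where
  "is_direct_sum sc L I V \<longleftrightarrow>
     (\<forall>i\<in>I. module.subspace sc (V i) \<and> V i \<subseteq> L) \<and>
     (\<forall>x\<in>L. \<exists>!v. v \<in> (\<Pi>\<^sub>E i\<in>I. V i) \<and> x = (\<Sum>i\<in>I. v i))"

definition connected_gradation ::
    "(complex \<Rightarrow> 'a::ab_group_add \<Rightarrow> 'a) \<Rightarrow> 'a set \<Rightarrow> ('a \<Rightarrow> 'a \<Rightarrow> 'a) \<Rightarrow>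
     int \<Rightarrow> nat \<Rightarrow> (int \<Rightarrow> 'a set) \<Rightarrow> bool" where
  "connected_gradation sc L br k t V \<longleftrightarrow>
     is_direct_sum sc L {k..k + int t} V \<and>
     (\<forall>i\<in>{k..k + int t}. V i \<noteq> {0}) \<and> (\<forall>i. i \<notin> {k..k + int t} \<longrightarrow> V i = {0}) \<and>
     (\<forall>i j. \<forall>x\<in>V i. \<forall>y\<in>V j. br x y \<in> V (i + j))"

definition algebra_length ::
    "(complex \<Rightarrow> 'a::ab_group_add \<Rightarrow> 'a) \<Rightarrow> 'a set \<Rightarrow> ('a \<Rightarrow> 'a \<Rightarrow> 'a) \<Rightarrow> nat" where
  "algebra_length sc L br = Max {t + 1 | t. \<exists>k V. connected_gradation sc L br k t V}"

definition max_length ::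
    "(complex \<Rightarrow> 'a::ab_group_add \<Rightarrow> 'a) \<Rightarrow> 'a set \<Rightarrow> ('a \<Rightarrow> 'a \<Rightarrow> 'a) \<Rightarrow> bool" where
  "max_length sc L br \<longleftrightarrow> algebra_length sc L br = vector_space.dim sc L"

definition is_ideal ::
    "(complex \<Rightarrow> 'a::ab_group_add \<Rightarrow> 'a) \<Rightarrow> 'a set \<Rightarrow> ('a \<Rightarrow> 'a \<Rightarrow> 'a) \<Rightarrow> 'a set \<Rightarrow> bool" where
  "is_ideal sc L br N \<longleftrightarrow>
     module.subspace sc N \<and> N \<subseteq> L \<and> (\<forall>x\<in>N. \<forall>y\<in>L. br x y \<in> N \<and> br y x \<in> N)"

definition standard_algebra ::
    "(complex \<Rightarrow> 'a::ab_group_add \<Rightarrow> 'a) \<Rightarrow> 'a set \<Rightarrow> ('a \<Rightarrow> 'a \<Rightarrow> 'a) \<Rightarrow> bool" where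
  "standard_algebra sc L br \<longleftrightarrow>
     max_length sc L br \<and>
     (\<exists>(k::nat) N. k \<ge> 2 \<and> is_direct_sum sc L {1..k} N \<and>
        (\<forall>i\<in>{1..k}. is_ideal sc L br (N i) \<and> N i \<noteq> {0} \<and> max_length sc (N i) br))"

definition non_standard_algebra ::
    "(complex \<Rightarrow> 'a::ab_group_add \<Rightarrow> 'a) \<Rightarrow> 'a set \<Rightarrow> ('a \<Rightarrow> 'a \<Rightarrow> 'a) \<Rightarrow> bool" where
  "non_standard_algebra sc L br \<longleftrightarrow> max_length sc L br \<and> \<not> standard_algebra sc L br"

(* The algebra with basis B in which the product of basis elements a and b has coordinates P a b. *)

definition table_alg :: "'b set \<Rightarrow> ('b \<Rightarrow> 'b \<Rightarrow> 'b \<Rightarrow> complex) \<Rightarrow> ('b \<Rightarrow> complex) alg" where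
  "table_alg B P =
     \<lparr>alg_carrier = {f. \<forall>b. b \<notin> B \<longrightarrow> f b = 0},
      alg_add = (\<lambda>f g b. f b + g b),
      alg_scale = (\<lambda>c f b. c * f b),
      alg_prod = (\<lambda>f g d. \<Sum>a\<in>B. \<Sum>b\<in>B. f a * g b * P a b d)\<rparr>"

definition unit_vec_at :: "'b \<Rightarrow> 'b \<Rightarrow> complex" where
  "unit_vec_at b = (\<lambda>d. if d = b then 1 else 0)"

definition KF4_prod :: "nat \<Rightarrow> nat \<Rightarrow> nat \<Rightarrow> nat \<Rightarrow> complex" where
  "KF4_prod n i j =
     (if j = 1 \<and> 1 \<le> i \<and> i \<le> n - 3 then unit_vec_at (i + 1)
      else if i = 1 \<and> j = n - 1 then unit_vec_at n
      else (\<lambda>_. 0))"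

definition KF4 :: "nat \<Rightarrow> (nat \<Rightarrow> complex) alg" where
  "KF4 n = table_alg {1..n} (KF4_prod n)"

definition zero_line :: "complex alg" where
  "zero_line = \<lparr>alg_carrier = UNIV, alg_add = (+), alg_scale = (*), alg_prod = (\<lambda>_ _. 0)\<rparr>"

datatype basis_elt = Y nat | Z1

definition basis_YZ :: "nat \<Rightarrow> basis_elt set" where
  "basis_YZ n = insert Z1 (Y ` {1..n})"

definition M_prod :: "nat \<Rightarrow> basis_elt \<Rightarrow> basis_elt \<Rightarrow> basis_elt \<Rightarrow> complex" where
  "M_prod n a b = (case (a, b) of
       (Y i, Y j) \<Rightarrow>
         (if j = 1 \<and> 1 \<le> i \<and> i \<le> n - 3 then unit_vec_at (Y (i + 1))
          else if i = 1 \<and> j = n - 1 then unit_vec_at (Y n)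
          else (\<lambda>_. 0))
     | (Z1, Y j) \<Rightarrow> (if j = n - 1 then unit_vec_at (Y (n - 2)) else (\<lambda>_. 0))
     | _ \<Rightarrow> (\<lambda>_. 0))"

definition M_alg :: "nat \<Rightarrow> (basis_elt \<Rightarrow> complex) alg" where
  "M_alg n = table_alg (basis_YZ n) (M_prod n)"

definition M1_prod :: "nat \<Rightarrow> complex \<Rightarrow> basis_elt \<Rightarrow> basis_elt \<Rightarrow> basis_elt \<Rightarrow> complex" where
  "M1_prod n \<alpha> a b = (case (a, b) of
       (Y i, Y j) \<Rightarrow>
         (if j = 1 \<and> 1 \<le> i \<and> i \<le> n - 3 then unit_vec_at (Y (i + 1))
          else if i = 1 \<and> j = n - 1 then unit_vec_at (Y n)
          else (\<lambda>_. 0))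
     | (Y i, Z1) \<Rightarrow> (if i = n - 1 then unit_vec_at (Y (n - 2)) else (\<lambda>_. 0))
     | (Z1, Y j) \<Rightarrow> (if j = n - 1 then (\<lambda>d. \<alpha> * unit_vec_at (Y (n - 2)) d) else (\<lambda>_. 0))
     | _ \<Rightarrow> (\<lambda>_. 0))"

definition M1_alg :: "nat \<Rightarrow> complex \<Rightarrow> (basis_elt \<Rightarrow> complex) alg" where
  "M1_alg n \<alpha> = table_alg (basis_YZ n) (M1_prod n \<alpha>)"

(* KF4 n is 2-filiform, with characteristic sequence (n-2,1,1), exactly for n \<ge> 4. For n = 5 and
   n = 6 the list M_alg, M1_alg is not complete: further non standard 3-filiform algebras of
   maximum length with gr L isomorphic to KF4 n + C are, for n = 5,
     [y1,y1] = y2, [y2,y1] = y3, [y1,y4] = y5, [z,z] = y3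
   in degrees y1:2, z:3, y2:4, y4:5, y3:6, y5:7, and, for n = 6,
     [y1,y1] = y2, [y2,y1] = y3, [y3,y1] = y4, [y1,y5] = y6, [y6,y5] = y4
   in degrees y1:2, y5:3, y2:4, y6:5, y3:6, z:7, y4:8. *)

end

theory Submission imports Defs begin

text \<open>
  A gradation of length \<open>dim L\<close> has one-dimensional components, and every \<open>L\<^sup>k\<close> is a homogeneous
  subspace. Hence homogeneous \<open>U\<close>, \<open>W\<close>, \<open>Z\<close> of degrees \<open>u\<close>, \<open>w\<close>, \<open>z\<close> can be chosen which in \<open>gr L\<close> play
  the roles of \<open>e\<^sub>1\<close>, \<open>e\<^sub>n\<^sub>-\<^sub>1\<close> and the generator of the one-dimensional summand: the kernels of the product
  on \<open>L / L\<^sup>2\<close> are homogeneous. The right powers of \<open>U\<close>, together with \<open>W\<close>, \<open>[U, W]\<close> and \<open>Z\<close>, form a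
  basis of \<open>L\<close> adapted to both filtration and gradation. A product of basis elements that does not come
  from \<open>gr L\<close> is a multiple of a power of \<open>U\<close> lying deeper in the filtration than expected. The degrees
  of the basis fill an interval of \<open>n + 1\<close> integers; for \<open>n \<ge> 7\<close> this forces \<open>u = \<plusminus> 1\<close>, and then comparing
  degrees leaves only \<open>[W, Z]\<close> and \<open>[Z, W]\<close>, both multiples of \<open>U\<^sup>n\<^sup>-\<^sup>2\<close>. For \<open>n = 4\<close> there is no room for
  deeper products at all. If both products vanish, \<open>L\<close> is standard; otherwise rescaling \<open>Z\<close> gives \<open>M\<close> or
  \<open>M\<^sup>1\<^sup>,\<^sup>\<alpha>\<close>.
\<close>

section \<open>Independent families and connected gradations\<close>

context vector_space
begin

text \<open>Families are indexed by degrees or by basis labels, and coefficients are compared index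
  by index. On a finite index set the condition includes injectivity of \<open>b\<close>, which
  independence of the image does not.\<close>

definition family_indep :: "'i set \<Rightarrow> ('i \<Rightarrow> 'b) \<Rightarrow> bool" where
  "family_indep I b \<longleftrightarrow> (\<forall>c. (\<Sum>i\<in>I. scale (c i) (b i)) = 0 \<longrightarrow> (\<forall>i\<in>I. c i = 0))"

end

context vector_space
begin

lemma family_indepD:
  "family_indep I b \<Longrightarrow> (\<Sum>i\<in>I. scale (c i) (b i)) = 0 \<Longrightarrow> i \<in> I \<Longrightarrow> c i = 0"
  by (auto simp: family_indep_def)

lemma family_indep_eq:
  assumes "family_indep I b" "(\<Sum>i\<in>I. scale (c i) (b i)) = (\<Sum>i\<in>I. scale (c' i) (b i))" "i \<in> I"
  shows "c i = c' i"
proof -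
  have "(\<Sum>i\<in>I. scale (c i - c' i) (b i)) = 0"
    using assms(2) by (simp add: scale_left_diff_distrib sum_subtractf)
  from family_indepD[OF assms(1) this assms(3)] show ?thesis by simp
qed

text \<open>Independence is tested on coefficients supported at \<open>i\<close> and
  \<open>j\<close>. Later this forbids two basis vectors in the same degree.\<close>

lemma family_indep_not_proportional:
  assumes "finite I" "family_indep I b" "i \<in> I" "j \<in> I" "i \<noteq> j" "scale x (b i) = scale y (b j)"
  shows "x = 0" "y = 0"
proof -
  define c where "c l = (if l = i then x else if l = j then - y else 0)" for l
  have "(\<Sum>l\<in>I. scale (c l) (b l)) = (\<Sum>l\<in>{i,j}. scale (c l) (b l))"
    by (rule sum.mono_neutral_right) (use assms in \<open>auto simp: c_def\<close>)
  also have "\<dots> = 0" using assms by (simp add: c_def)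
  finally have "\<forall>l\<in>I. c l = 0" using assms(2) by (auto simp: family_indep_def)
  then have "c i = 0" "c j = 0" using assms by auto
  then show "x = 0" "y = 0" using assms(5) by (auto simp: c_def split: if_splits)
qed

lemma family_indep_inj: "finite I \<Longrightarrow> family_indep I b \<Longrightarrow> inj_on b I"
  using family_indep_not_proportional[of I b _ _ 1 1] by (auto simp: inj_on_def)

lemma family_indep_nonzero: 
  assumes "finite I" "family_indep I b" "i \<in> I" shows "b i \<noteq> 0"
proof
  assume "b i = 0"
  then have "(\<Sum>l\<in>I. scale (if l = i then 1 else 0) (b l)) = 0"
    by (intro sum.neutral) auto
  from family_indepD[OF assms(2) this assms(3)] show False by simp
qed

lemma family_indep_imp_independent:
  assumes "finite I" "family_indep I b"
  shows "independent (b ` I)"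
proof -
  have inj: "inj_on b I" by (rule family_indep_inj[OF assms])
  { fix u v assume v: "v \<in> b ` I" "u v \<noteq> 0" and s: "(\<Sum>v\<in>b ` I. scale (u v) v) = 0"
    have "(\<Sum>i\<in>I. scale (u (b i)) (b i)) = 0" using s by (simp add: sum.reindex[OF inj])
    from family_indepD[OF assms(2) this] v have False by auto }
  then show ?thesis using assms(1) by (auto simp: dependent_finite)
qed

lemma span_family_iff:
  assumes "finite I"
  shows "x \<in> span (b ` I) \<longleftrightarrow> (\<exists>c. x = (\<Sum>i\<in>I. scale (c i) (b i)))"
proof
  assume "x \<in> span (b ` I)"
  then show "\<exists>c. x = (\<Sum>i\<in>I. scale (c i) (b i))"
  proof (induction rule: span_induct_alt)
    case base
    show ?case by (intro exI[of _ "\<lambda>_. 0"]) simp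
  next
    case (step a x y)
    from step(1) obtain j where j: "j \<in> I" "x = b j" by auto
    from step(2) obtain c where c: "y = (\<Sum>i\<in>I. scale (c i) (b i))" by auto
    have "(\<Sum>i\<in>I. scale (c i + (if i = j then a else 0)) (b i)) =
        y + (\<Sum>i\<in>I. scale (if i = j then a else 0) (b i))"
      by (simp add: scale_left_distrib sum.distrib c)
    also have "(\<Sum>i\<in>I. scale (if i = j then a else 0) (b i)) = (\<Sum>i\<in>I. if i = j then scale a (b j) else 0)"
      by (rule sum.cong) auto
    also have "\<dots> = scale a (b j)" using assms j by simp
    finally show ?case using j by (intro exI[of _ "\<lambda>i. c i + (if i = j then a else 0)"]) (simp add: add.commute)
  qed
next
  assume "\<exists>c. x = (\<Sum>i\<in>I. scale (c i) (b i))"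
  then show "x \<in> span (b ` I)" by (auto intro!: span_sum span_scale intro: span_base)
qed

lemma independent_card_le:
  assumes "finite B" "L = span B" "independent S" "S \<subseteq> L"
  shows "finite S" "card S \<le> dim L"
proof -
  obtain C where C: "C \<subseteq> L" "independent C" "L \<subseteq> span C" "card C = dim L"
    by (rule basis_exists)
  have "finite C" using independent_span_bound[OF assms(1) C(2)] C(1) assms(2) by auto
  from independent_span_bound[OF this assms(3)] assms(4) C show "finite S" "card S \<le> dim L" by auto
qed

lemma family_indep_card_le:
  assumes "finite B" "L = span B" "finite I" "family_indep I b" "b ` I \<subseteq> L"
  shows "card I \<le> dim L"
  using independent_card_le(2)[OF assms(1,2) family_indep_imp_independent[OF assms(3,4)] assms(5)]
    card_image[OF family_indep_inj[OF assms(3,4)]] by simp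

text \<open>A vector of \<open>L\<close> outside the span would extend the family to an independent
  set with more than \<open>dim L\<close> elements.\<close>

lemma family_indep_spans:
  assumes "finite B" "L = span B" "finite I" "family_indep I b" "b ` I \<subseteq> L" "card I = dim L"
  shows "span (b ` I) = L"
proof
  show "span (b ` I) \<subseteq> L" using assms(2,5) by (simp add: span_minimal)
  show "L \<subseteq> span (b ` I)"
  proof
    fix x assume x: "x \<in> L"
    show "x \<in> span (b ` I)"
    proof (rule ccontr)
      assume n: "x \<notin> span (b ` I)"
      then have "x \<notin> b ` I" using span_base by blast
      have "independent (insert x (b ` I))"
        using independent_insertI[OF n family_indep_imp_independent[OF assms(3,4)]] .
      from independent_card_le(2)[OF assms(1,2) this] x assms(5)
      have "card (insert x (b ` I)) \<le> dim L" by auto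
      then show False using \<open>x \<notin> b ` I\<close> assms(3,6) card_image[OF family_indep_inj[OF assms(3,4)]] by simp
    qed
  qed
qed

end

section \<open>Direct sums and the length of a gradation\<close>

locale complex_vector_space = vector_space scale
  for scale :: "complex \<Rightarrow> 'a::ab_group_add \<Rightarrow> 'a"
begin

text \<open>\<open>is_direct_sum\<close> asserts uniqueness among extensional functions only;
  restricting both families to \<open>I\<close> brings arbitrary functions under it.\<close>

lemma is_direct_sum_unique:
  assumes "is_direct_sum scale L I V" "\<And>i. i \<in> I \<Longrightarrow> v i \<in> V i" "\<And>i. i \<in> I \<Longrightarrow> w i \<in> V i"
    "(\<Sum>i\<in>I. v i) = (\<Sum>i\<in>I. w i)" "(\<Sum>i\<in>I. v i) \<in> L" "i \<in> I"
  shows "v i = w i"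
proof -
  let ?x = "\<Sum>i\<in>I. v i"
  have ex: "\<exists>!u. u \<in> (\<Pi>\<^sub>E i\<in>I. V i) \<and> ?x = (\<Sum>i\<in>I. u i)"
    using assms(1,5) unfolding is_direct_sum_def by blast
  have 1: "restrict v I \<in> (\<Pi>\<^sub>E i\<in>I. V i) \<and> ?x = (\<Sum>i\<in>I. restrict v I i)"
    using assms(2) by auto
  have 2: "restrict w I \<in> (\<Pi>\<^sub>E i\<in>I. V i) \<and> ?x = (\<Sum>i\<in>I. restrict w I i)"
    using assms(3,4) by auto
  have "restrict v I = restrict w I" using ex 1 2 by blast
  from fun_cong[OF this, of i] assms(6) show ?thesis by simp
qed

text \<open>A vanishing combination and the zero family are two decompositions of 0.\<close>

lemma is_direct_sum_family_indep:
  assumes "is_direct_sum scale L I V" "0 \<in> L" "\<And>i. i \<in> I \<Longrightarrow> h i \<in> V i \<and> h i \<noteq> 0"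
  shows "family_indep I h"
  unfolding family_indep_def
proof (intro allI impI ballI)
  fix c i assume s: "(\<Sum>i\<in>I. scale (c i) (h i)) = 0" and i: "i \<in> I"
  have sub: "subspace (V i)" if "i \<in> I" for i
    using assms(1) that unfolding is_direct_sum_def by blast
  have "scale (c i) (h i) = 0"
    by (rule is_direct_sum_unique[OF assms(1), where w = "\<lambda>_. 0" and v = "\<lambda>i. scale (c i) (h i)"])
       (use s i assms(2,3) sub subspace_scale subspace_0 in auto)
  then show "c i = 0" using assms(3)[OF i] by simp
qed

text \<open>One nonzero vector from each component gives an independent family. The bound also makes
  the set under \<open>Max\<close> in \<open>algebra_length\<close> finite.\<close>

lemma gradation_length_le:
  assumes "finite B" "L = span B" "connected_gradation scale L br k t V"
  shows "t + 1 \<le> dim L"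
proof -
  let ?D = "{k..k + int t}"
  have ds: "is_direct_sum scale L ?D V" and nz: "\<forall>i\<in>?D. V i \<noteq> {0}"
    using assms(3) unfolding connected_gradation_def by auto
  have sub: "subspace (V i)" "V i \<subseteq> L" if "i \<in> ?D" for i
    using ds that unfolding is_direct_sum_def by blast+
  have "\<forall>i\<in>?D. \<exists>x. x \<in> V i \<and> x \<noteq> 0" using nz sub(1) subspace_0 by blast
  then obtain h where h: "\<And>i. i \<in> ?D \<Longrightarrow> h i \<in> V i \<and> h i \<noteq> 0" by metis
  have "family_indep ?D h" by (rule is_direct_sum_family_indep[OF ds _ h]) (use assms(2) span_zero in auto)
  from family_indep_card_le[OF assms(1,2) _ this] h sub have "card ?D \<le> dim L" by fastforce
  then show ?thesis by simp
qed

lemma max_lengthI: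
  assumes "finite B" "L = span B" "connected_gradation scale L br k t V" "t + 1 = dim L"
  shows "max_length scale L br"
proof -
  let ?S = "{t + 1 | t. \<exists>k V. connected_gradation scale L br k t V}"
  have le: "s \<le> dim L" if "s \<in> ?S" for s using that gradation_length_le[OF assms(1,2)] by auto
  have "dim L \<in> ?S" using assms(3,4) by force
  moreover have "finite ?S" using le by (intro finite_subset[of ?S "{..dim L}"]) auto
  ultimately have "Max ?S = dim L" using le by (intro Max_eqI) auto
  then show ?thesis by (simp add: max_length_def algebra_length_def)
qed

end

section \<open>Leibniz algebras: descending central sequence and homogeneous bases\<close>

locale leib = complex_vector_space sc for sc :: "complex \<Rightarrow> 'a::ab_group_add \<Rightarrow> 'a" +
  fixes L :: "'a set" and br :: "'a \<Rightarrow> 'a \<Rightarrow> 'a"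
  assumes leibniz_alg: "leibniz_algebra sc L br"
begin

lemma L_subspace: "subspace L"
  and L_span: "\<exists>B. finite B \<and> span B = L"
  and br_closed: "x \<in> L \<Longrightarrow> y \<in> L \<Longrightarrow> br x y \<in> L"
  and br_add_left: "x \<in> L \<Longrightarrow> y \<in> L \<Longrightarrow> z \<in> L \<Longrightarrow> br (x + y) z = br x z + br y z"
  and br_add_right: "x \<in> L \<Longrightarrow> y \<in> L \<Longrightarrow> z \<in> L \<Longrightarrow> br x (y + z) = br x y + br x z"
  and br_scale_left: "x \<in> L \<Longrightarrow> y \<in> L \<Longrightarrow> br (sc c x) y = sc c (br x y)"
  and br_scale_right: "x \<in> L \<Longrightarrow> y \<in> L \<Longrightarrow> br x (sc c y) = sc c (br x y)"
  and leibniz: "x \<in> L \<Longrightarrow> y \<in> L \<Longrightarrow> z \<in> L \<Longrightarrow> br x (br y z) = br (br x y) z - br (br x z) y"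
  using leibniz_alg unfolding leibniz_algebra_def fd_algebra_def by auto

lemmas L_simps [simp] =
  subspace_0[OF L_subspace] subspace_add[OF L_subspace] subspace_scale[OF L_subspace]
  subspace_diff[OF L_subspace] br_closed

lemma L_sum [intro]: "(\<And>i. i \<in> I \<Longrightarrow> f i \<in> L) \<Longrightarrow> sum f I \<in> L"
  using L_subspace subspace_sum by blast

lemma br_zero_left [simp]: "y \<in> L \<Longrightarrow> br 0 y = 0"
  using br_scale_left[of 0 y 0] by simp

lemma br_zero_right [simp]: "x \<in> L \<Longrightarrow> br x 0 = 0"
  using br_scale_right[of x 0 0] by simp

lemma br_sum_left:
  "(\<And>i. i \<in> I \<Longrightarrow> f i \<in> L) \<Longrightarrow> y \<in> L \<Longrightarrow> br (sum f I) y = (\<Sum>i\<in>I. br (f i) y)"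
proof (induction I rule: infinite_finite_induct)
  case (insert i I)
  have "sum f I \<in> L" using insert by auto
  then show ?case using insert by (simp add: br_add_left)
qed auto

lemma br_sum_right:
  "(\<And>i. i \<in> I \<Longrightarrow> f i \<in> L) \<Longrightarrow> y \<in> L \<Longrightarrow> br y (sum f I) = (\<Sum>i\<in>I. br y (f i))"
proof (induction I rule: infinite_finite_induct)
  case (insert i I)
  have "sum f I \<in> L" using insert by auto
  then show ?case using insert by (simp add: br_add_right)
qed auto

abbreviation LC :: "nat \<Rightarrow> 'a set" where "LC \<equiv> lcs sc L br"

lemma LC_subset_L: "LC k \<subseteq> L"
proof (induction k rule: lcs.induct[of "\<lambda>_ _ _ k. LC k \<subseteq> L" sc L br])
  case (3 sc' L' br' k)
  have "span {br a b | a b. a \<in> LC (Suc k) \<and> b \<in> L} \<subseteq> L"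
    by (rule span_minimal) (use 3 L_subspace in auto)
  then show ?case by simp
qed auto

lemma LC_subspace: "subspace (LC k)"
  by (cases k rule: nat.exhaust; cases "k - 1") (auto simp: L_subspace)

lemmas LC_simps [simp] =
  subspace_0[OF LC_subspace] subspace_add[OF LC_subspace] subspace_scale[OF LC_subspace]
  subspace_diff[OF LC_subspace]

lemma LC_br1: "a \<in> LC k \<Longrightarrow> b \<in> L \<Longrightarrow> br a b \<in> LC (Suc k)"
  by (cases k) (auto intro!: span_base)

lemma LC_Suc_subset: "LC (Suc k) \<subseteq> LC k"
proof (induction k)
  case (Suc k)
  show ?case
  proof (cases k)
    case 0
    then show ?thesis using LC_subset_L[of "Suc (Suc 0)"] by simp
  next
    case (Suc m)
    have "span {br a b | a b. a \<in> LC (Suc k) \<and> b \<in> L} \<subseteq> span {br a b | a b. a \<in> LC k \<and> b \<in> L}"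
      by (rule span_mono) (use Suc.IH in blast)
    then show ?thesis using Suc by simp
  qed
qed simp

lemma LC_antimono: "i \<le> j \<Longrightarrow> LC j \<subseteq> LC i"
  by (rule lift_Suc_antimono_le[of LC]) (use LC_Suc_subset in auto)

lemma LC_antimonoD: "x \<in> LC j \<Longrightarrow> i \<le> j \<Longrightarrow> x \<in> LC i"
  using LC_antimono by blast

lemma LC_L: "x \<in> LC k \<Longrightarrow> x \<in> L"
  using LC_subset_L by blast

text \<open>The recursion of \<open>lcs\<close> multiplies by elements of \<open>L\<close> on the
  right only. For b = [p,q] the Leibniz identity gives [a,b] = [[a,p],q] - [[a,q],p], where p lies
  one step higher than b. The second term raises \<open>i\<close> by one, so \<open>i\<close> and
  \<open>a\<close> must be arbitrary in the induction.\<close>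

lemma LC_br: "a \<in> LC i \<Longrightarrow> b \<in> LC j \<Longrightarrow> br a b \<in> LC (i + j)"
proof (induction j arbitrary: i a b rule: less_induct)
  case (less j)
  consider "j = 0" | "j = 1" | k where "j = Suc (Suc k)"
    by (metis One_nat_def not0_implies_Suc)
  then show ?case
  proof cases
    case 1
    then show ?thesis using less.prems LC_br1 LC_antimonoD[of _ "Suc i" i] by auto
  next
    case 2
    then show ?thesis using less.prems LC_br1 by auto
  next
    case 3
    have aL: "a \<in> L" using less.prems LC_L by blast
    have "b \<in> span {br a b | a b. a \<in> LC (Suc k) \<and> b \<in> L}" using less.prems 3 by simp
    \<comment> \<open>Membership in \<open>L\<close> is carried along because \<open>br\<close> is
      bilinear on \<open>L\<close> only.\<close>
    then have "b \<in> L \<and> br a b \<in> LC (i + j)"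
    proof (induction rule: span_induct_alt)
      case base
      then show ?case using aL by simp
    next
      case (step c x y)
      then obtain p q where pq: "x = br p q" "p \<in> LC (Suc k)" "q \<in> L" by auto
      have pL: "p \<in> L" using pq LC_L by blast
      have "br (br a p) q \<in> LC (i + j)"
        using LC_br1[OF less.IH[of "Suc k" a i p] pq(3)] less.prems pq 3 by simp
      moreover have "br (br a q) p \<in> LC (i + j)"
        using less.IH[of "Suc k" "br a q" "Suc i" p] LC_br1[OF less.prems(1) pq(3)] pq 3 by simp
      ultimately have "br a x \<in> LC (i + j)" using leibniz[OF aL pL pq(3)] pq by simp
      moreover have "x \<in> L" using pL pq by simp
      ultimately show ?case using step aL
        by (simp add: br_add_right br_scale_right)
    qed
    then show ?thesis by simp
  qed
qed

lemma max_lengthD: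
  assumes "max_length sc L br" "L \<noteq> {0}"
  obtains k t V where "connected_gradation sc L br k t V" "t + 1 = dim L"
proof -
  obtain B where B: "finite B" "L = span B" using L_span by metis
  let ?S = "{t + 1 | t. \<exists>k V. connected_gradation sc L br k t V}"
  have fin: "finite ?S"
    using gradation_length_le[OF B] by (intro finite_subset[of ?S "{..dim L}"]) auto
  \<comment> \<open>\<open>Max\<close> is informative only on a nonempty set: the gradation
    concentrated in degree 0 always exists.\<close>
  have "is_direct_sum sc L {0..0 + int 0} (\<lambda>i. if i = 0 then L else {0})"
    unfolding is_direct_sum_def
  proof (intro conjI ballI)
    fix x assume x: "x \<in> L"
    show "\<exists>!v. v \<in> (\<Pi>\<^sub>E i\<in>{0..0 + int 0}. if i = 0 then L else {0}) \<and> x = (\<Sum>i\<in>{0..0 + int 0}. v i)"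
    proof (rule ex1I[of _ "restrict (\<lambda>_. x) {0}"])
      fix v assume "v \<in> (\<Pi>\<^sub>E i\<in>{0..0 + int 0}. if i = 0 then L else {0}) \<and> x = (\<Sum>i\<in>{0..0 + int 0}. v i)"
      then show "v = restrict (\<lambda>_. x) {0}" by (auto simp: PiE_def extensional_def)
    qed (use x in auto)
  qed (use L_subspace in auto)
  then have "connected_gradation sc L br 0 0 (\<lambda>i. if i = 0 then L else {0})"
    unfolding connected_gradation_def using assms(2) by auto
  then have "?S \<noteq> {}" by blast
  from Max_in[OF fin this] have "dim L \<in> ?S" using assms(1) 
    by (simp add: max_length_def algebra_length_def)
  then show ?thesis using that by (auto; metis)
qed

text \<open>There are as many nonzero components as dimensions, so each component is a line and
  \<open>h\<close> picks a generator of it.\<close>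

lemma homogeneous_basis:
  assumes "max_length sc L br" "dim L = n + 1"
  obtains k h where "\<And>d. d \<notin> {k..k + int n} \<Longrightarrow> h d = 0" "family_indep {k..k + int n} h"
    "\<And>d. h d \<in> L" "\<And>d e. \<exists>c. br (h d) (h e) = sc c (h (d + e))"
proof -
  obtain B where B: "finite B" "L = span B" using L_span by metis
  have "L \<noteq> {0}"
  proof
    assume "L = {0}"
    then have "dim L \<le> card ({} :: 'a set)" by (intro dim_le_card) auto
    then show False using assms(2) by simp
  qed
  with assms(1) obtain k t V where cg: "connected_gradation sc L br k t V" "t + 1 = dim L"
    by (rule max_lengthD)
  let ?D = "{k..k + int n}"
  have t: "t = n" using cg(2) assms(2) by simp
  have ds: "is_direct_sum sc L ?D V" and nz: "\<forall>i\<in>?D. V i \<noteq> {0}" and out: "\<And>i. i \<notin> ?D \<Longrightarrow> V i = {0}"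
    and mult: "\<And>i j x y. x \<in> V i \<Longrightarrow> y \<in> V j \<Longrightarrow> br x y \<in> V (i + j)"
    using cg(1) t unfolding connected_gradation_def by auto
  have sub: "subspace (V i)" "V i \<subseteq> L" if "i \<in> ?D" for i
    using ds that unfolding is_direct_sum_def by blast+
  \<comment> \<open>The choice is nonzero exactly on the interval of degrees. The zero values
    outside let the product rule hold for all \<open>d\<close> and \<open>e\<close>, including those
    with \<open>d + e\<close> out of range.\<close>
  have "\<forall>i. \<exists>x. x \<in> V i \<and> (i \<in> ?D \<longleftrightarrow> x \<noteq> 0)" using nz sub(1) subspace_0 out by (metis singleton_iff equals0D subsetI subset_singletonD)
  then obtain h where h: "\<And>i. h i \<in> V i" "\<And>i. i \<in> ?D \<longleftrightarrow> h i \<noteq> 0" by metis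
  have indep: "family_indep ?D h" by (rule is_direct_sum_family_indep[OF ds]) (use h in auto)
  have hL: "h d \<in> L" for d using h[of d] sub(2)[of d] by (cases "d \<in> ?D") auto
  have spn: "span (h ` ?D) = L"
    by (rule family_indep_spans[OF B _ indep]) (use hL assms(2) in auto)
  \<comment> \<open>The expansion of \<open>x\<close> in \<open>h\<close> and the decomposition
    concentrated in degree \<open>d\<close> must agree componentwise.\<close>
  have line: "\<exists>c. x = sc c (h d)" if x: "x \<in> V d" for x d
  proof (cases "d \<in> ?D")
    case True
    then have "x \<in> L" using x sub by auto
    then obtain c where c: "x = (\<Sum>e\<in>?D. sc (c e) (h e))"
      using span_family_iff[of ?D x h] spn by auto
    have s: "(\<Sum>e\<in>?D. if e = d then x else 0) = x" using True by simp
    have m: "sc (c e) (h e) \<in> V e" "(if e = d then x else 0) \<in> V e" if "e \<in> ?D" for e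
      using subspace_scale[OF sub(1)[OF that] h(1)] subspace_0[OF sub(1)[OF that]] x by auto
    have "sc (c d) (h d) = (if d = d then x else 0)"
      using is_direct_sum_unique[OF ds m _ _ True] s c \<open>x \<in> L\<close> by simp
    then show ?thesis by (auto intro: exI[of _ "c d"])
  next
    case False
    then show ?thesis using x out by auto
  qed
  show ?thesis
    by (rule that[of k h]) (use h indep hL line mult in auto)
qed

text \<open>The way back from a homogeneous family to a gradation; it provides the gradations of the
  two ideals in the split case.\<close>

lemma family_gradation:
  assumes "\<And>d. d \<notin> {k..k + int t} \<Longrightarrow> b d = 0" "family_indep {k..k + int t} b"
    "\<And>d. b d \<in> L" "\<And>d e. \<exists>c. br (b d) (b e) = sc c (b (d + e))"
  shows "connected_gradation sc (span (b ` {k..k + int t})) br k t (\<lambda>d. span {b d})"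
proof -
  let ?D = "{k..k + int t}" and ?V = "\<lambda>d. span {b d}"
  have sing: "x \<in> span {y} \<longleftrightarrow> (\<exists>c. x = sc c y)" for x y by (auto simp: span_singleton)
  have "is_direct_sum sc (span (b ` ?D)) ?D ?V"
    unfolding is_direct_sum_def
  proof (intro conjI ballI)
    fix i assume "i \<in> ?D" then show "?V i \<subseteq> span (b ` ?D)" by (intro span_mono) auto
  next
    fix x assume "x \<in> span (b ` ?D)"
    then obtain c where c: "x = (\<Sum>i\<in>?D. sc (c i) (b i))" using span_family_iff[of ?D x b] by auto
    show "\<exists>!v. v \<in> (\<Pi>\<^sub>E i\<in>?D. ?V i) \<and> x = (\<Sum>i\<in>?D. v i)"
    proof (rule ex1I[of _ "restrict (\<lambda>i. sc (c i) (b i)) ?D"])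
      show "restrict (\<lambda>i. sc (c i) (b i)) ?D \<in> (\<Pi>\<^sub>E i\<in>?D. ?V i) \<and>
          x = (\<Sum>i\<in>?D. restrict (\<lambda>i. sc (c i) (b i)) ?D i)"
        using c by (auto simp: sing)
    next
      fix v assume v: "v \<in> (\<Pi>\<^sub>E i\<in>?D. ?V i) \<and> x = (\<Sum>i\<in>?D. v i)"
      then have "\<forall>i\<in>?D. \<exists>a. v i = sc a (b i)" by (auto simp: PiE_iff sing)
      then obtain c' where c': "\<And>i. i \<in> ?D \<Longrightarrow> v i = sc (c' i) (b i)" by metis
      have "(\<Sum>i\<in>?D. sc (c i) (b i)) = (\<Sum>i\<in>?D. sc (c' i) (b i))" using v c c' by simp
      then have "c i = c' i" if "i \<in> ?D" for i using family_indep_eq[OF assms(2)] that by blast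
      then show "v = restrict (\<lambda>i. sc (c i) (b i)) ?D"
        using v c' by (intro extensionalityI[of v ?D]) (auto simp: PiE_iff)
    qed
  qed simp
  moreover have "?V i \<noteq> {0}" if "i \<in> ?D" for i
    using family_indep_nonzero[OF _ assms(2) that] span_base[of "b i" "{b i}"] by auto
  moreover have "?V i = {0}" if "i \<notin> ?D" for i using assms(1)[OF that] by simp
  moreover have "br x y \<in> ?V (i + j)" if xy: "x \<in> ?V i" "y \<in> ?V j" for i j x y
  proof -
    obtain p q where "x = sc p (b i)" "y = sc q (b j)" using xy sing by metis
    moreover obtain r where "br (b i) (b j) = sc r (b (i + j))" using assms(4) by blast
    ultimately have "br x y = sc (p * (q * r)) (b (i + j))"
      using assms(3) by (simp add: br_scale_left br_scale_right)
    then show ?thesis by (auto simp: sing)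
  qed
  ultimately show ?thesis unfolding connected_gradation_def by auto
qed

end

section \<open>Coordinates on the associated graded algebra\<close>

lemma KF4_simps:
  "alg_carrier (KF4 n) = {f. \<forall>b. b \<notin> {1..n} \<longrightarrow> f b = 0}"
  "alg_add (KF4 n) f g = (\<lambda>b. f b + g b)"
  "alg_scale (KF4 n) c f = (\<lambda>b. c * f b)"
  by (auto simp: KF4_def table_alg_def)

text \<open>Only e_1 and e_(n-1) occur as right factors, so the inner sum keeps two terms, and each
  coordinate of the product receives at most one contribution.\<close>

lemma KF4_prod:
  assumes "n \<ge> 4"
  shows "alg_prod (KF4 n) f g d = (if 2 \<le> d \<and> d \<le> n - 2 then f (d - 1) * g 1
     else if d = n then f 1 * g (n - 1) else 0)"
proof -
  have n: "1 \<noteq> n - 1" "1 \<in> {1..n}" "n - 1 \<in> {1..n}" using assms by auto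
  have in1: "(\<Sum>b\<in>{1..n}. f a * g b * KF4_prod n a b d) =
      f a * g 1 * KF4_prod n a 1 d + f a * g (n - 1) * KF4_prod n a (n - 1) d" for a
  proof -
    have "(\<Sum>b\<in>{1..n}. f a * g b * KF4_prod n a b d) = (\<Sum>b\<in>{1,n-1}. f a * g b * KF4_prod n a b d)"
      by (rule sum.mono_neutral_right) (use assms in \<open>auto simp: KF4_prod_def\<close>)
    then show ?thesis using n by simp
  qed
  have t1: "(\<Sum>a\<in>{1..n}. f a * g 1 * KF4_prod n a 1 d) = (if 2 \<le> d \<and> d \<le> n - 2 then f (d - 1) * g 1 else 0)"
  proof -
    have "f a * g 1 * KF4_prod n a 1 d =
        (if a = d - 1 then (if 2 \<le> d \<and> d \<le> n - 2 then f (d - 1) * g 1 else 0) else 0)" if "a \<in> {1..n}" for a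
      using that assms by (auto simp: KF4_prod_def unit_vec_at_def)
    then have "(\<Sum>a\<in>{1..n}. f a * g 1 * KF4_prod n a 1 d) =
      (\<Sum>a\<in>{1..n}. if a = d - 1 then (if 2 \<le> d \<and> d \<le> n - 2 then f (d - 1) * g 1 else 0) else 0)"
      by (rule sum.cong[OF refl])
    also have "\<dots> = (if 2 \<le> d \<and> d \<le> n - 2 then f (d - 1) * g 1 else 0)"
      by (subst sum.delta) auto
    finally show ?thesis .
  qed
  have t2: "(\<Sum>a\<in>{1..n}. f a * g (n - 1) * KF4_prod n a (n - 1) d) = (if d = n then f 1 * g (n - 1) else 0)"
  proof -
    have "f a * g (n - 1) * KF4_prod n a (n - 1) d =
        (if a = 1 then (if d = n then f 1 * g (n - 1) else 0) else 0)" for a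
      using assms by (auto simp: KF4_prod_def unit_vec_at_def)
    then show ?thesis using assms by (simp add: sum.delta)
  qed
  have "alg_prod (KF4 n) f g d = (\<Sum>a\<in>{1..n}. \<Sum>b\<in>{1..n}. f a * g b * KF4_prod n a b d)"
    by (simp add: KF4_def table_alg_def)
  also have "\<dots> = (\<Sum>a\<in>{1..n}. f a * g 1 * KF4_prod n a 1 d) + (\<Sum>a\<in>{1..n}. f a * g (n - 1) * KF4_prod n a (n - 1) d)"
    unfolding in1 by (rule sum.distrib)
  also have "\<dots> = (if 2 \<le> d \<and> d \<le> n - 2 then f (d - 1) * g 1
     else if d = n then f 1 * g (n - 1) else 0)"
    unfolding t1 t2 using assms by auto
  finally show ?thesis .
qed

section \<open>The associated graded algebra, computed on representatives\<close>

context leib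
begin

definition coset :: "nat \<Rightarrow> 'a \<Rightarrow> 'a set" where
  "coset k a = (\<lambda>c. a + c) ` LC k"

lemma mem_coset: "x \<in> coset k a \<longleftrightarrow> x - a \<in> LC k"
  unfolding coset_def by (auto intro: image_eqI[of _ _ "x - a"])

lemma coset_0 [simp]: "coset k 0 = LC k"
  by (auto simp: mem_coset)

lemma coset_eq_iff: "coset k a = coset k b \<longleftrightarrow> a - b \<in> LC k"
proof
  assume "coset k a = coset k b"
  then have "a \<in> coset k b" by (metis LC_simps(1) diff_self mem_coset)
  then show "a - b \<in> LC k" by (simp add: mem_coset)
next
  assume ab: "a - b \<in> LC k"
  show "coset k a = coset k b"
  proof (intro Set.set_eqI)
    fix x
    have 1: "x - b = (x - a) + (a - b)" and 2: "x - a = (x - b) - (a - b)" by simp_all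
    show "x \<in> coset k a \<longleftrightarrow> x \<in> coset k b"
      unfolding mem_coset using LC_simps(2)[OF _ ab, of "x - a"] LC_simps(4)[OF _ ab, of "x - b"] 1 2
      by metis
  qed
qed

lemma coset_add: "{x + y | x y. x \<in> coset k a \<and> y \<in> coset k b} = coset k (a + b)"
proof (intro Set.set_eqI iffI)
  fix z assume "z \<in> {x + y | x y. x \<in> coset k a \<and> y \<in> coset k b}"
  then obtain x y where z: "z = x + y" "x - a \<in> LC k" "y - b \<in> LC k" by (auto simp: mem_coset)
  have "(x - a) + (y - b) \<in> LC k" using z(2,3) by (rule LC_simps)
  then show "z \<in> coset k (a + b)" by (simp add: mem_coset z(1) algebra_simps)
next
  fix z assume "z \<in> coset k (a + b)"
  then have "z - a - b \<in> LC k" by (simp add: mem_coset algebra_simps)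
  then show "z \<in> {x + y | x y. x \<in> coset k a \<and> y \<in> coset k b}"
    by (intro CollectI exI[of _ a] exI[of _ "z - a"]) (auto simp: mem_coset)
qed

lemma coset_scale: "{sc c x + y | x y. x \<in> coset k a \<and> y \<in> LC k} = coset k (sc c a)"
proof (intro Set.set_eqI iffI)
  fix z assume "z \<in> {sc c x + y | x y. x \<in> coset k a \<and> y \<in> LC k}"
  then obtain x y where z: "z = sc c x + y" "x - a \<in> LC k" "y \<in> LC k" by (auto simp: mem_coset)
  have "sc c (x - a) + y \<in> LC k" by (rule LC_simps(2)[OF LC_simps(3)[OF z(2)] z(3)])
  then show "z \<in> coset k (sc c a)" by (simp add: mem_coset z(1) algebra_simps scale_right_diff_distrib)
next
  fix z assume "z \<in> coset k (sc c a)"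
  then show "z \<in> {sc c x + y | x y. x \<in> coset k a \<and> y \<in> LC k}"
    by (intro CollectI exI[of _ a] exI[of _ "z - sc c a"]) (auto simp: mem_coset)
qed

text \<open>Elements of gr are handled through families of representatives, one in each L^j, on
  which the operations of \<open>gr_alg\<close> become the operations of \<open>L\<close>.\<close>

definition gr_fam :: "(nat \<Rightarrow> 'a) \<Rightarrow> nat \<Rightarrow> 'a set" where
  "gr_fam x = (\<lambda>j. coset (Suc j) (x j))"

abbreviation G :: "(nat \<Rightarrow> 'a set) alg" where "G \<equiv> gr_alg sc L br"

lemma gr_fam_carrier:
  assumes "\<And>j. x j \<in> LC j" "finite {j. x j \<noteq> 0}"
  shows "gr_fam x \<in> alg_carrier G"
proof -
  have "finite {j. gr_fam x j \<noteq> LC (Suc j)}"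
    by (rule finite_subset[OF _ assms(2)]) (auto simp: gr_fam_def)
  moreover have "gr_fam x j \<in> lcs_quotient sc L br j" for j
    unfolding gr_fam_def coset_def lcs_quotient_def using assms(1) by (rule imageI)
  ultimately show ?thesis by (simp add: gr_alg_def)
qed

lemma gr_carrierE:
  assumes "f \<in> alg_carrier G"
  obtains x where "\<And>j. x j \<in> LC j" "finite {j. x j \<noteq> 0}" "f = gr_fam x"
proof -
  have q: "\<And>j. f j \<in> lcs_quotient sc L br j" and fin: "finite {j. f j \<noteq> LC (Suc j)}"
    using assms by (auto simp: gr_alg_def)
  \<comment> \<open>Zero cosets receive the representative 0, so finite support of \<open>f\<close>
    becomes finite support of the representatives.\<close>
  have "\<forall>j. \<exists>a. a \<in> LC j \<and> f j = coset (Suc j) a \<and> (f j = LC (Suc j) \<longrightarrow> a = 0)"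
  proof
    fix j
    show "\<exists>a. a \<in> LC j \<and> f j = coset (Suc j) a \<and> (f j = LC (Suc j) \<longrightarrow> a = 0)"
    proof (cases "f j = LC (Suc j)")
      case True
      then show ?thesis by (intro exI[of _ 0]) simp
    next
      case False
      then show ?thesis using q[of j] by (auto simp: lcs_quotient_def coset_def)
    qed
  qed
  then obtain x where x: "\<And>j. x j \<in> LC j" "\<And>j. f j = coset (Suc j) (x j)"
    "\<And>j. f j = LC (Suc j) \<Longrightarrow> x j = 0" by metis
  have "finite {j. x j \<noteq> 0}" by (rule finite_subset[OF _ fin]) (use x(3) in blast)
  moreover have "f = gr_fam x" unfolding gr_fam_def using x(2) by (rule ext)
  ultimately show ?thesis using that[of x] x(1) by blast
qed

lemma gr_fam_add: "alg_add G (gr_fam x) (gr_fam y) = gr_fam (\<lambda>j. x j + y j)"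
  by (simp add: gr_alg_def gr_fam_def coset_add)

lemma gr_fam_scale: "alg_scale G c (gr_fam x) = gr_fam (\<lambda>j. sc c (x j))"
  by (simp add: gr_alg_def gr_fam_def coset_scale)

text \<open>Well-definedness of the product of gr. With a' = a + p and b' = b + q the difference is
  [a,q] + [p,b+q], and each term gains one step from q or from p.\<close>

lemma br_coset_diff:
  assumes "a \<in> LC i" "b \<in> LC j" "a' - a \<in> LC (Suc i)" "b' - b \<in> LC (Suc j)"
  shows "br a' b' - br a b \<in> LC (Suc (i + j))"
proof -
  define p q where "p = a' - a" and "q = b' - b"
  have pq: "a' = a + p" "b' = b + q" "p \<in> LC (Suc i)" "q \<in> LC (Suc j)"
    using assms by (auto simp: p_def q_def)
  have L: "a \<in> L" "b \<in> L" "p \<in> L" "q \<in> L" using assms pq LC_L by blast+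
  have q': "q \<in> LC j" using pq(4) LC_Suc_subset by blast
  have "br a' b' - br a b = br a q + br p (b + q)"
    using L by (simp add: pq br_add_left br_add_right)
  moreover have "br a q \<in> LC (Suc (i + j))" using LC_br[OF assms(1) pq(4)] by simp
  moreover have "br p (b + q) \<in> LC (Suc (i + j))"
    using LC_br[OF pq(3), of "b + q" j] assms(2) q' by simp
  ultimately show ?thesis by simp
qed

lemma gr_fam_prod:
  assumes "\<And>j. x j \<in> LC j" "\<And>j. y j \<in> LC j"
  shows "alg_prod G (gr_fam x) (gr_fam y) = gr_fam (\<lambda>k. \<Sum>i\<le>k. br (x i) (y (k - i)))"
proof
  fix k
  let ?s = "\<Sum>i\<le>k. br (x i) (y (k - i))"
  have "alg_prod G (gr_fam x) (gr_fam y) k = {(\<Sum>i\<le>k. br (a i) (b (k - i))) + c | a b c.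
         (\<forall>i. a i \<in> coset (Suc i) (x i)) \<and> (\<forall>i. b i \<in> coset (Suc i) (y i)) \<and> c \<in> LC (Suc k)}"
    by (simp add: gr_alg_def gr_fam_def)
  also have "\<dots> = coset (Suc k) ?s"
  proof (intro Set.set_eqI iffI)
    fix z assume "z \<in> {(\<Sum>i\<le>k. br (a i) (b (k - i))) + c | a b c.
         (\<forall>i. a i \<in> coset (Suc i) (x i)) \<and> (\<forall>i. b i \<in> coset (Suc i) (y i)) \<and> c \<in> LC (Suc k)}"
    then obtain a b c where z: "z = (\<Sum>i\<le>k. br (a i) (b (k - i))) + c" "c \<in> LC (Suc k)"
      and ab: "\<And>i. a i - x i \<in> LC (Suc i)" "\<And>i. b i - y i \<in> LC (Suc i)"
      by (auto simp: mem_coset)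
    have "(\<Sum>i\<le>k. br (a i) (b (k - i)) - br (x i) (y (k - i))) \<in> LC (Suc k)"
    proof (rule subspace_sum[OF LC_subspace])
      fix i assume "i \<in> {..k}"
      then show "br (a i) (b (k - i)) - br (x i) (y (k - i)) \<in> LC (Suc k)"
        using br_coset_diff[OF assms(1) assms(2) ab, of i "k - i"] by simp
    qed
    then have "(\<Sum>i\<le>k. br (a i) (b (k - i))) - ?s + c \<in> LC (Suc k)"
      using z(2) by (simp add: sum_subtractf)
    then show "z \<in> coset (Suc k) ?s" by (simp add: mem_coset z(1) algebra_simps)
  next
    fix z assume "z \<in> coset (Suc k) ?s"
    then have "z = (\<Sum>i\<le>k. br (x i) (y (k - i))) + (z - ?s)" "z - ?s \<in> LC (Suc k)"
      by (auto simp: mem_coset)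
    moreover have "x i \<in> coset (Suc i) (x i)" "y i \<in> coset (Suc i) (y i)" for i
      by (auto simp: mem_coset)
    ultimately show "z \<in> {(\<Sum>i\<le>k. br (a i) (b (k - i))) + c | a b c.
         (\<forall>i. a i \<in> coset (Suc i) (x i)) \<and> (\<forall>i. b i \<in> coset (Suc i) (y i)) \<and> c \<in> LC (Suc k)}"
      by blast
  qed
  finally show "alg_prod G (gr_fam x) (gr_fam y) k = gr_fam (\<lambda>k. \<Sum>i\<le>k. br (x i) (y (k - i))) k"
    by (simp add: gr_fam_def)
qed

text \<open>Here \<open>hom\<close> stands for homogeneous: the class of \<open>a\<close> in L^i /
  L^(i+1), placed in degree \<open>i\<close>.\<close>

definition gr_hom :: "nat \<Rightarrow> 'a \<Rightarrow> nat \<Rightarrow> 'a set" where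
  "gr_hom i a = gr_fam (\<lambda>j. if j = i then a else 0)"

lemma gr_hom_carrier: "a \<in> LC i \<Longrightarrow> gr_hom i a \<in> alg_carrier G"
  unfolding gr_hom_def by (rule gr_fam_carrier) auto

lemma gr_hom_add: "alg_add G (gr_hom i a) (gr_hom i b) = gr_hom i (a + b)"
  unfolding gr_hom_def gr_fam_add by (rule arg_cong[of _ _ gr_fam]) auto

lemma gr_hom_scale: "alg_scale G c (gr_hom i a) = gr_hom i (sc c a)"
  unfolding gr_hom_def gr_fam_scale by (rule arg_cong[of _ _ gr_fam]) auto

lemma gr_hom_prod:
  assumes "a \<in> LC i" "b \<in> LC j"
  shows "alg_prod G (gr_hom i a) (gr_hom j b) = gr_hom (i + j) (br a b)"
proof -
  have L: "a \<in> L" "b \<in> L" using assms LC_L by blast+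
  have "alg_prod G (gr_hom i a) (gr_hom j b) =
      gr_fam (\<lambda>k. \<Sum>l\<le>k. br (if l = i then a else 0) (if k - l = j then b else 0))"
    unfolding gr_hom_def by (rule gr_fam_prod) (use assms in auto)
  also have "(\<lambda>k. \<Sum>l\<le>k. br (if l = i then a else 0) (if k - l = j then b else 0)) =
      (\<lambda>k. if k = i + j then br a b else 0)"
  proof
    fix k
    have "(\<Sum>l\<le>k. br (if l = i then a else 0) (if k - l = j then b else 0)) =
        (\<Sum>l\<le>k. if l = i then (if k = i + j then br a b else 0) else 0)"
      by (rule sum.cong) (use L in auto)
    also have "\<dots> = (if k = i + j then br a b else 0)"
      by (subst sum.delta) auto
    finally show "(\<Sum>l\<le>k. br (if l = i then a else 0) (if k - l = j then b else 0)) =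
        (if k = i + j then br a b else 0)" .
  qed
  finally show ?thesis by (simp add: gr_hom_def)
qed

lemma gr_hom_eq_zero: "a \<in> LC (Suc i) \<Longrightarrow> gr_hom i a = gr_hom i 0"
  by (auto simp: gr_hom_def gr_fam_def fun_eq_iff coset_eq_iff[of _ _ 0, simplified])

end

text \<open>\<open>ps i a p\<close> is the coordinate of the class of \<open>a \<in> L\<^sup>i\<close> in \<open>gr L\<close> along \<open>e\<^sub>p\<close>, and along the
  one-dimensional summand if \<open>p = 0\<close>.\<close>

locale gr_coords = leib sc L br for sc :: "complex \<Rightarrow> 'a::ab_group_add \<Rightarrow> 'a" and L br +
  fixes n :: nat and ps :: "nat \<Rightarrow> 'a \<Rightarrow> nat \<Rightarrow> complex"
  assumes n_ge: "n \<ge> 4"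
    and ps_add: "a \<in> LC i \<Longrightarrow> b \<in> LC i \<Longrightarrow> ps i (a + b) p = ps i a p + ps i b p"
    and ps_scale: "a \<in> LC i \<Longrightarrow> ps i (sc c a) p = c * ps i a p"
    and ps_LC_Suc: "a \<in> LC (Suc i) \<Longrightarrow> ps i a p = 0"
    and ps_br: "a \<in> LC i \<Longrightarrow> b \<in> LC j \<Longrightarrow> ps (i + j) (br a b) p =
      (if 2 \<le> p \<and> p \<le> n - 2 then ps i a (p - 1) * ps j b 1
       else if p = n then ps i a 1 * ps j b (n - 1) else 0)"
begin

lemma ps_zero [simp]: "ps i 0 p = 0"
  using ps_scale[of 0 i 0 p] by simp

lemma ps_sum:
  "(\<And>j. j \<in> I \<Longrightarrow> f j \<in> LC i) \<Longrightarrow> ps i (sum f I) p = (\<Sum>j\<in>I. ps i (f j) p)"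
proof (induction I rule: infinite_finite_induct)
  case (insert j I)
  have "sum f I \<in> LC i" using insert by (auto intro: subspace_sum[OF LC_subspace])
  then show ?case using insert by (simp add: ps_add)
qed auto

text \<open>The isomorphism with \<open>KF4\<close> plus a line is not assumed to respect degrees;
  products force this. L^k is spanned by products from L^(k-1) and L, and such a product has
  coordinate \<open>p\<close> only if its left factor has coordinate \<open>p - 1\<close>, or if
  \<open>p = n\<close> and the left factor has coordinate 1. Induction on \<open>k\<close> excludes
  the listed coordinates.\<close>

lemma ps_vanish:
  "a \<in> LC k \<Longrightarrow> k \<ge> 2 \<Longrightarrow> p < k \<or> p = n - 1 \<or> p = n \<and> k \<ge> 3 \<Longrightarrow> ps k a p = 0"
proof (induction k arbitrary: a p)
  case (Suc k)
  then obtain m where m: "k = Suc m" by (cases k) auto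
  have "a \<in> span {br a b | a b. a \<in> LC k \<and> b \<in> L}" using Suc.prems m by simp
  then have "a \<in> LC (Suc k) \<and> ps (Suc k) a p = 0"
  proof (induction rule: span_induct_alt)
    case base
    then show ?case by simp
  next
    case (step c x y)
    then obtain u v where uv: "x = br u v" "u \<in> LC k" "v \<in> L" by auto
    have x: "x \<in> LC (Suc k)" using uv LC_br1 by simp
    have "ps (Suc k) x p = (if 2 \<le> p \<and> p \<le> n - 2 then ps k u (p - 1) * ps 1 v 1
       else if p = n then ps k u 1 * ps 1 v (n - 1) else 0)"
      using ps_br[OF uv(2), of v 1 p] uv by simp
    also have "\<dots> = 0"
    proof -
      have "ps k u (p - 1) = 0" if "2 \<le> p" "p \<le> n - 2"
      proof -
        from that Suc.prems n_ge have "p < Suc k" by auto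
        then show ?thesis using that by (intro Suc.IH[OF uv(2)]) auto
      qed
      moreover have "ps k u 1 = 0" if "p = n"
        using that Suc.prems(3) n_ge by (intro Suc.IH[OF uv(2)]) auto
      ultimately show ?thesis by auto
    qed
    finally show ?case using step x by (simp add: ps_add ps_scale)
  qed
  then show ?case by blast
qed simp

end

text \<open>What is kept of the surjectivity of the isomorphism: on \<open>L\<close> the three
  generator coordinates take all values simultaneously.\<close>

locale gr_KF4 = gr_coords +
  assumes ps_onto: "\<exists>x\<in>L. ps 1 x 1 = r \<and> ps 1 x (n - 1) = s \<and> ps 1 x 0 = t"

lemma (in leib) gr_KF4_exists:
  assumes iso: "alg_isomorphic (gr_alg sc L br) (alg_direct_sum (KF4 n) zero_line)" and n: "n \<ge> 4"
  shows "\<exists>ps. gr_KF4 sc L br n ps"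
proof -
  let ?K = "alg_direct_sum (KF4 n) zero_line"
  obtain \<phi> where bij: "bij_betw \<phi> (alg_carrier G) (alg_carrier ?K)"
    and add: "\<And>x y. x \<in> alg_carrier G \<Longrightarrow> y \<in> alg_carrier G \<Longrightarrow> \<phi> (alg_add G x y) = alg_add ?K (\<phi> x) (\<phi> y)"
    and scl: "\<And>c x. x \<in> alg_carrier G \<Longrightarrow> \<phi> (alg_scale G c x) = alg_scale ?K c (\<phi> x)"
    and prd: "\<And>x y. x \<in> alg_carrier G \<Longrightarrow> y \<in> alg_carrier G \<Longrightarrow> \<phi> (alg_prod G x y) = alg_prod ?K (\<phi> x) (\<phi> y)"
    using iso unfolding alg_isomorphic_def by blast
  define co :: "(nat \<Rightarrow> complex) \<times> complex \<Rightarrow> nat \<Rightarrow> complex" where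
    "co v p = (if p = 0 then snd v else fst v p)" for v p
  have co_add: "co (alg_add ?K v w) p = co v p + co w p" for v w p
    by (cases v; cases w) (auto simp: co_def alg_direct_sum_def KF4_simps zero_line_def)
  have co_scale: "co (alg_scale ?K c v) p = c * co v p" for c v p
    by (cases v) (auto simp: co_def alg_direct_sum_def KF4_simps zero_line_def)
  have co_prod: "co (alg_prod ?K v w) p = (if 2 \<le> p \<and> p \<le> n - 2 then co v (p - 1) * co w 1
       else if p = n then co v 1 * co w (n - 1) else 0)" for v w p
    using n by (cases v; cases w) (auto simp: co_def alg_direct_sum_def zero_line_def KF4_prod[OF n])
  define ps where "ps i a p = co (\<phi> (gr_hom i a)) p" for i a p
  have ps_add: "ps i (a + b) p = ps i a p + ps i b p" if "a \<in> LC i" "b \<in> LC i" for i a b p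
    using that by (simp add: ps_def gr_hom_add[symmetric] add gr_hom_carrier co_add)
  have ps_scale: "ps i (sc c a) p = c * ps i a p" if "a \<in> LC i" for i c a p
    using that by (simp add: ps_def gr_hom_scale[symmetric] scl gr_hom_carrier co_scale)
  have ps_0: "ps i 0 p = 0" for i p using ps_scale[of 0 i 0 p] by simp
  interpret gr_coords sc L br n ps
  proof unfold_locales
    show "ps i a p = 0" if "a \<in> LC (Suc i)" for a i p
      using ps_0[of i p] unfolding ps_def gr_hom_eq_zero[OF that] .
    show "ps (i + j) (br a b) p = (if 2 \<le> p \<and> p \<le> n - 2 then ps i a (p - 1) * ps j b 1
       else if p = n then ps i a 1 * ps j b (n - 1) else 0)" if "a \<in> LC i" "b \<in> LC j" for a i b j p
      using that by (simp add: ps_def gr_hom_prod[symmetric] prd gr_hom_carrier co_prod)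
  qed (use ps_add ps_scale n in auto)
  \<comment> \<open>The coordinates 0, 1 and n-1 vanish in every degree other than 1, so for any
    element of gr they can be read off its degree 1 part. Homogeneous parts are split off from the
    top.\<close>
  have lead: "co (\<phi> (gr_fam x)) p = ps 1 (x 1) p"
    if "\<And>j. x j \<in> LC j" "\<And>j. j \<ge> N \<Longrightarrow> x j = 0" "p = 0 \<or> p = 1 \<or> p = n - 1" for x N p
    using that
  proof (induction N arbitrary: x)
    case 0
    then have "x = (\<lambda>_. 0)" by auto
    then have "gr_fam x = gr_hom 1 0" by (simp add: gr_hom_def)
    moreover have "x 1 = 0" using 0 by simp
    ultimately show ?case by (simp only: ps_def)
  next
    case (Suc N)
    define y where "y = x(N := 0)"
    have y: "\<And>j. y j \<in> LC j" "\<And>j. j \<ge> N \<Longrightarrow> y j = 0"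
      using Suc.prems by (auto simp: y_def)
    have xy: "gr_fam x = alg_add G (gr_fam y) (gr_hom N (x N))"
      unfolding gr_hom_def gr_fam_add by (rule arg_cong[of _ _ gr_fam]) (auto simp: y_def)
    have "finite {j. y j \<noteq> 0}"
      by (rule finite_subset[of _ "{..<N}"]) (use y(2) in \<open>auto simp: not_le[symmetric]\<close>)
    then have "gr_fam y \<in> alg_carrier G" using gr_fam_carrier y(1) by blast
    then have "co (\<phi> (gr_fam x)) p = ps 1 (y 1) p + ps N (x N) p"
      using gr_hom_carrier[of "x N" N] Suc.prems(1) Suc.IH[OF y Suc.prems(3)]
      by (simp add: xy add co_add ps_def)
    also have "\<dots> = ps 1 (x 1) p"
    proof -
      consider "N = 0" | "N = 1" | "N \<ge> 2" by linarith
      then show ?thesis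
      proof cases
        case 1
        \<comment> \<open>By convention L^0 = L^1, so the degree 0 part of gr is zero.\<close>
        then have "x N \<in> LC (Suc N)" using Suc.prems(1)[of 0] by simp
        then show ?thesis using ps_LC_Suc 1 by (simp add: y_def)
      next
        case 2
        then show ?thesis by (simp add: y_def ps_0)
      next
        case 3
        then have "ps N (x N) p = 0" using Suc.prems(1,3) by (intro ps_vanish) auto
        then show ?thesis using 3 by (simp add: y_def)
      qed
    qed
    finally show ?case .
  qed
  have "gr_KF4 sc L br n ps"
  proof unfold_locales
    fix r s t :: complex
    \<comment> \<open>The target is r e_1 + s e_(n-1) plus \<open>t\<close> in the summand; the
      degree 1 representative of its preimage is the required element.\<close>
    define v where "v = ((\<lambda>p. if p = 1 then r else if p = n - 1 then s else 0) :: nat \<Rightarrow> complex, t)"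
    have "v \<in> alg_carrier ?K" using n
      by (auto simp: v_def alg_direct_sum_def KF4_simps zero_line_def)
    then have "v \<in> \<phi> ` alg_carrier G" using bij_betw_imp_surj_on[OF bij] by simp
    then obtain f where f: "f \<in> alg_carrier G" "\<phi> f = v" by (elim imageE) simp
    obtain x where x: "\<And>j. x j \<in> LC j" "finite {j. x j \<noteq> 0}" "f = gr_fam x"
      using gr_carrierE[OF f(1)] by blast
    obtain N where N: "{j. x j \<noteq> 0} \<subseteq> {..<N}" using x(2) finite_nat_bounded by blast
    then have z: "x j = 0" if "j \<ge> N" for j using that by force
    have "ps 1 (x 1) p = co v p" if "p = 0 \<or> p = 1 \<or> p = n - 1" for p
      using lead[of x N p, OF x(1) z that] x(3) f(2) by simp
    moreover have "co v 1 = r" "co v (n - 1) = s" "co v 0 = t" using n by (auto simp: co_def v_def)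
    moreover have "x 1 \<in> L" using x(1)[of 1] by simp
    ultimately show "\<exists>x\<in>L. ps 1 x 1 = r \<and> ps 1 x (n - 1) = s \<and> ps 1 x 0 = t" by metis
  qed
  then show ?thesis by blast
qed

section \<open>Adapted bases and homogeneous generators\<close>

lemma finite_basis_YZ [simp]: "finite (basis_YZ n)"
  by (simp add: basis_YZ_def)

lemma card_basis_YZ [simp]: "card (basis_YZ n) = n + 1"
proof -
  have "Z1 \<notin> Y ` {1..n}" by auto
  then show ?thesis by (simp add: basis_YZ_def card_image inj_on_def)
qed

lemma in_basis_YZ [simp]: "Y i \<in> basis_YZ n \<longleftrightarrow> 1 \<le> i \<and> i \<le> n" "Z1 \<in> basis_YZ n"
  by (auto simp: basis_YZ_def)

lemma basis_YZ_cases [consumes 2, case_names power W UW Z]: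
  assumes "e \<in> basis_YZ n" "n \<ge> 4"
  obtains i where "e = Y i" "1 \<le> i" "i \<le> n - 2" | "e = Y (n - 1)" | "e = Y n" | "e = Z1"
proof (cases e)
  case (Y i)
  then have "1 \<le> i" "i \<le> n" using assms by auto
  then consider "i \<le> n - 2" | "i = n - 1" | "i = n" by linarith
  then show ?thesis using that Y \<open>1 \<le> i\<close> by cases auto
qed (use that in auto)

text \<open>The step of the descending central sequence in which the basis vector labelled
  \<open>e\<close> lives: U^i in step i, W and Z in step 1, [U,W] in step 2.\<close>

definition level :: "nat \<Rightarrow> basis_elt \<Rightarrow> nat" where
  "level n e = (case e of Y i \<Rightarrow> if i \<le> n - 2 then i else if i = n - 1 then 1 else 2 | Z1 \<Rightarrow> 1)"

lemma level_simps [simp]: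
  "i \<le> n - 2 \<Longrightarrow> level n (Y i) = i" "n \<ge> 4 \<Longrightarrow> level n (Y (n - 1)) = 1" "n \<ge> 4 \<Longrightarrow> level n (Y n) = 2"
  "n \<ge> 4 \<Longrightarrow> level n (Y (n - Suc 0)) = 1"
  "level n Z1 = 1"
  by (auto simp: level_def)

text \<open>The coordinates which detect \<open>L\<^sup>k\<^sup>+\<^sup>1\<close> inside \<open>L\<^sup>k\<close>.\<close>

definition lead :: "nat \<Rightarrow> nat \<Rightarrow> nat set" where
  "lead n k = (if k = 1 then {0, 1, n - 1} else if k = 2 then {2, n} else {k})"

context leib
begin

text \<open>Right multiplication is iterated \<open>i - 1\<close> times, so that for
  \<open>i \<ge> 1\<close> the index of the power is also its step in the central sequence.\<close>

definition rpow :: "'a \<Rightarrow> nat \<Rightarrow> 'a" where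
  "rpow U i = ((\<lambda>x. br x U) ^^ (i - 1)) U"

lemma rpow_1 [simp]: "rpow U 1 = U" "rpow U (Suc 0) = U"
  by (simp_all add: rpow_def)

lemma rpow_Suc: "i \<ge> 1 \<Longrightarrow> rpow U (Suc i) = br (rpow U i) U"
  by (cases i) (simp_all add: rpow_def)

lemma rpow_LC: "i \<ge> 1 \<Longrightarrow> U \<in> L \<Longrightarrow> rpow U i \<in> LC i"
proof (induction i rule: nat_induct_at_least)
  case (Suc i)
  then show ?case using LC_br1[of "rpow U i" i U] by (simp add: rpow_Suc)
qed simp

definition adapted_basis :: "nat \<Rightarrow> 'a \<Rightarrow> 'a \<Rightarrow> 'a \<Rightarrow> basis_elt \<Rightarrow> 'a" where
  "adapted_basis n U W Z e = (case e of
     Y i \<Rightarrow> if i \<le> n - 2 then rpow U i else if i = n - 1 then W else br U W | Z1 \<Rightarrow> Z)"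

end

text \<open>The coordinates of U, W, Z along e_1, e_(n-1) and the summand form a triangular matrix
  with nonzero diagonal; the remaining coordinates of U and W are left free.\<close>

locale adapted_triple = gr_KF4 sc L br n ps
  for sc :: "complex \<Rightarrow> 'a::ab_group_add \<Rightarrow> 'a" and L br n ps +
  fixes U W Z :: 'a
  assumes dim_L: "dim L = n + 1"
    and triple_L: "U \<in> L" "W \<in> L" "Z \<in> L"
    and ps_U: "ps 1 U 1 \<noteq> 0"
    and ps_W: "ps 1 W 1 = 0" "ps 1 W (n - 1) \<noteq> 0"
    and ps_Z: "ps 1 Z 1 = 0" "ps 1 Z (n - 1) = 0" "ps 1 Z 0 \<noteq> 0"
begin

abbreviation "E \<equiv> basis_YZ n"
abbreviation "lev \<equiv> level n"
abbreviation "B \<equiv> adapted_basis n U W Z"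

lemma B_simps [simp]:
  "i \<le> n - 2 \<Longrightarrow> B (Y i) = rpow U i" "B (Y (n - 1)) = W" "B (Y (n - Suc 0)) = W" "B (Y n) = br U W" "B Z1 = Z"
  using n_ge by (auto simp: adapted_basis_def)

lemma level_pos: "e \<in> E \<Longrightarrow> 1 \<le> lev e"
  using n_ge by (auto simp: level_def split: basis_elt.splits)

lemma B_LC:
  assumes "e \<in> E" shows "B e \<in> LC (lev e)"
  using assms n_ge
proof (cases rule: basis_YZ_cases)
  case UW
  then show ?thesis using n_ge LC_br[of U 1 W 1] triple_L by (simp add: numeral_2_eq_2)
qed (use n_ge triple_L rpow_LC in auto)

lemma B_L: "e \<in> E \<Longrightarrow> B e \<in> L"
  using B_LC LC_L by blast

lemma ps_rpow: "i \<ge> 1 \<Longrightarrow> i \<le> n - 2 \<Longrightarrow> ps i (rpow U i) i = ps 1 U 1 ^ i"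
proof (induction i rule: nat_induct_at_least)
  case (Suc i)
  have "ps (i + 1) (br (rpow U i) U) (Suc i) = ps i (rpow U i) i * ps 1 U 1"
    using Suc.hyps Suc.prems triple_L by (subst ps_br) (auto intro: rpow_LC)
  then show ?case using Suc by (simp add: rpow_Suc)
qed simp

lemma ps_UW: "ps 2 (br U W) 2 = 0" "ps 2 (br U W) n = ps 1 U 1 * ps 1 W (n - 1)"
proof -
  have "U \<in> LC 1" "W \<in> LC 1" using triple_L by simp_all
  from ps_br[OF this] have "ps 2 (br U W) p = (if 2 \<le> p \<and> p \<le> n - 2 then ps 1 U (p - 1) * ps 1 W 1
       else if p = n then ps 1 U 1 * ps 1 W (n - 1) else 0)" for p by (simp add: numeral_2_eq_2)
  then show "ps 2 (br U W) 2 = 0" "ps 2 (br U W) n = ps 1 U 1 * ps 1 W (n - 1)"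
    using n_ge ps_W by auto
qed

lemma level_cases:
  assumes "e \<in> E"
  shows "(\<exists>i. e = Y i \<and> 1 \<le> i \<and> i \<le> n - 2 \<and> lev e = i) \<or> e = Y (n - 1) \<and> lev e = 1 \<or>
    e = Y n \<and> lev e = 2 \<or> e = Z1 \<and> lev e = 1"
  using assms n_ge by (cases rule: basis_YZ_cases) (use n_ge in simp_all)

lemma level_eq_set:
  "{e \<in> E. lev e = 1} = {Y 1, Y (n - 1), Z1}" "{e \<in> E. lev e = 2} = {Y 2, Y n}"
  "k \<ge> 3 \<Longrightarrow> {e \<in> E. lev e = k} \<subseteq> {Y k}"
proof -
  show "{e \<in> E. lev e = 1} = {Y 1, Y (n - 1), Z1}"
  proof
    show "{e \<in> E. lev e = 1} \<subseteq> {Y 1, Y (n - 1), Z1}" using level_cases by fastforce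
    show "{Y 1, Y (n - 1), Z1} \<subseteq> {e \<in> E. lev e = 1}" using n_ge by simp
  qed
  show "{e \<in> E. lev e = 2} = {Y 2, Y n}"
  proof
    show "{e \<in> E. lev e = 2} \<subseteq> {Y 2, Y n}" using level_cases by fastforce
    show "{Y 2, Y n} \<subseteq> {e \<in> E. lev e = 2}" using n_ge by simp
  qed
  show "k \<ge> 3 \<Longrightarrow> {e \<in> E. lev e = k} \<subseteq> {Y k}" using level_cases by fastforce
qed

text \<open>In degree \<open>k\<close> only the basis vectors of level \<open>k\<close> contribute:
  lower ones have coefficient 0, higher ones lie in L^(k+1). Their leading coordinates form a
  triangular system with nonzero diagonal.\<close>

lemma lead_coeffs_vanish:
  assumes c: "\<And>e. e \<in> E \<Longrightarrow> lev e < k \<Longrightarrow> c e = 0" and k: "k \<ge> 1"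
    and lead: "\<And>p. p \<in> lead n k \<Longrightarrow> ps k (\<Sum>e\<in>E. sc (c e) (B e)) p = 0"
    and e: "e \<in> E" "lev e = k"
  shows "c e = 0"
proof -
  have term_LC: "sc (c e) (B e) \<in> LC k" if "e \<in> E" for e
  proof (cases "lev e < k")
    case False
    then show ?thesis using B_LC[OF that] LC_antimonoD by (auto simp: not_less)
  qed (use c that in simp)
  have tm: "ps k (sc (c e) (B e)) p = (if lev e = k then c e * ps k (B e) p else 0)" if "e \<in> E" for e p
  proof -
    consider "lev e < k" | "lev e = k" | "lev e > k" by linarith
    then show ?thesis
    proof cases
      case 3
      then have "B e \<in> LC (Suc k)" using B_LC[OF that] LC_antimonoD by (auto simp: Suc_le_eq)
      then show ?thesis using 3 by (simp add: ps_LC_Suc)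
    qed (use c B_LC that in \<open>auto simp: ps_scale\<close>)
  qed
  have sm: "(\<Sum>e | e \<in> E \<and> lev e = k. c e * ps k (B e) p) = 0" if "p \<in> lead n k" for p
  proof -
    have "ps k (\<Sum>e\<in>E. sc (c e) (B e)) p = (\<Sum>e\<in>E. if lev e = k then c e * ps k (B e) p else 0)"
      by (subst ps_sum) (use term_LC tm in auto)
    also have "\<dots> = (\<Sum>e | e \<in> E \<and> lev e = k. c e * ps k (B e) p)"
      by (simp add: sum.inter_filter)
    finally show ?thesis using lead[OF that] by simp
  qed
  consider "k = 1" | "k = 2" | "k \<ge> 3" using k by linarith
  then show ?thesis
  proof cases
    case 1
    have ne: "Y 1 \<noteq> Y (n - 1)" using n_ge by simp
    have s: "c (Y 1) * ps 1 U p + c (Y (n - 1)) * ps 1 W p + c Z1 * ps 1 Z p = 0"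
      if "p \<in> {0, 1, n - 1}" for p
      using sm[of p] that 1 ne n_ge unfolding 1 level_eq_set(1) lead_def by (simp add: add.assoc)
    \<comment> \<open>The triangular system is solved in the order of the coordinates 1, n-1,
      0.\<close>
    have "c (Y 1) = 0" using s[of 1] ps_U ps_W ps_Z by simp
    moreover from this have "c (Y (n - 1)) = 0" using s[of "n - 1"] ps_W ps_Z by simp
    moreover from calculation have "c Z1 = 0" using s[of 0] ps_Z by simp
    moreover have "e \<in> {e \<in> E. lev e = 1}" using e 1 by simp
    then have "e = Y 1 \<or> e = Y (n - 1) \<or> e = Z1" unfolding level_eq_set by simp
    ultimately show ?thesis by metis
  next
    case 2
    have ne: "Y 2 \<noteq> Y n" using n_ge by simp
    have s: "c (Y 2) * ps 2 (rpow U 2) p + c (Y n) * ps 2 (br U W) p = 0" if "p \<in> {2, n}" for p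
      using sm[of p] that ne n_ge unfolding 2 level_eq_set(2) lead_def by simp
    have "c (Y 2) = 0" using s[of 2] ps_U ps_UW ps_rpow[of 2] n_ge by simp
    moreover from this have "c (Y n) = 0" using s[of n] ps_UW ps_U ps_W by simp
    moreover have "e \<in> {e \<in> E. lev e = 2}" using e 2 by simp
    then have "e = Y 2 \<or> e = Y n" unfolding level_eq_set by simp
    ultimately show ?thesis by metis
  next
    case 3
    have ek: "e = Y k" and kn: "k \<le> n - 2" using level_cases[OF e(1)] e(2) 3 by auto
    have "{e \<in> E. lev e = k} = {Y k}"
      by (rule equalityI[OF level_eq_set(3)[OF 3]]) (use e ek in simp)
    then have "c (Y k) * ps k (rpow U k) k = 0" using sm[of k] kn 3 by (simp add: lead_def)
    then show ?thesis using ps_rpow[of k] kn 3 ps_U ek by simp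
  qed
qed

text \<open>The filtration is climbed one step at a time: once the coefficients below level
  \<open>k\<close> vanish, membership in L^(k+1) kills the leading coordinates in degree
  \<open>k\<close>, hence the coefficients of level \<open>k\<close>.\<close>

lemma coeff_LC:
  "(\<Sum>e\<in>E. sc (c e) (B e)) \<in> LC k \<Longrightarrow> e \<in> E \<Longrightarrow> lev e < k \<Longrightarrow> c e = 0"
proof (induction k arbitrary: e)
  case (Suc k)
  have "(\<Sum>e\<in>E. sc (c e) (B e)) \<in> LC k" using Suc.prems(1) LC_Suc_subset by blast
  from Suc.IH[OF this] have IH: "\<And>e. e \<in> E \<Longrightarrow> lev e < k \<Longrightarrow> c e = 0" .
  show ?case
  proof (cases "lev e < k")
    case False
    then have k: "lev e = k" using Suc.prems by simp
    show ?thesis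
      by (rule lead_coeffs_vanish[OF IH _ _ Suc.prems(2) k])
         (use k level_pos[OF Suc.prems(2)] ps_LC_Suc[OF Suc.prems(1)] in auto)
  qed (use IH Suc.prems in auto)
qed simp

text \<open>The zero vector lies in every L^k, so \<open>coeff_LC\<close> applies just beyond the
  level of each \<open>e\<close>.\<close>

lemma B_indep: "family_indep E B"
  unfolding family_indep_def
proof (intro allI impI ballI)
  fix c e assume "(\<Sum>i\<in>E. sc (c i) (B i)) = 0" "e \<in> E"
  then show "c e = 0" using coeff_LC[of c "Suc (lev e)" e] by simp
qed

lemma B_span: "span (B ` E) = L"
proof -
  obtain A where "finite A" "L = span A" using L_span by metis
  then show ?thesis by (rule family_indep_spans[OF _ _ _ B_indep]) (use B_L dim_L in auto)
qed

lemma B_expand: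
  assumes "x \<in> L" obtains c where "x = (\<Sum>e\<in>E. sc (c e) (B e))"
  using assms B_span span_family_iff[of E x B] by auto

text \<open>In the expansion of \<open>x\<close> the levels below \<open>k\<close> vanish by
  membership in L^k and level \<open>k\<close> by the leading coordinates; what remains lies in
  L^(k+1).\<close>

lemma lead_LC_Suc:
  assumes "x \<in> LC k" "k \<ge> 1" "\<And>p. p \<in> lead n k \<Longrightarrow> ps k x p = 0"
  shows "x \<in> LC (Suc k)"
proof -
  obtain c where c: "x = (\<Sum>e\<in>E. sc (c e) (B e))" using B_expand LC_L[OF assms(1)] by blast
  have lt: "c e = 0" if "e \<in> E" "lev e < k" for e using coeff_LC[of c k e] assms(1) c that by simp
  have eq: "c e = 0" if "e \<in> E" "lev e = k" for e
    by (rule lead_coeffs_vanish[OF lt assms(2) _ that]) (use assms(3) c in auto)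
  have "sc (c e) (B e) \<in> LC (Suc k)" if e: "e \<in> E" for e
  proof (cases "lev e \<le> k")
    case False
    then show ?thesis using B_LC[OF e] LC_antimonoD[of "B e" "lev e" "Suc k"] by simp
  qed (use lt eq e in force)
  then show ?thesis unfolding c by (rule subspace_sum[OF LC_subspace])
qed

end

section \<open>Homogeneous subspaces and homogeneous generators\<close>

locale graded_KF4 = gr_KF4 sc L br n ps
  for sc :: "complex \<Rightarrow> 'a::ab_group_add \<Rightarrow> 'a" and L br n ps +
  fixes k :: int and h :: "int \<Rightarrow> 'a"
  assumes dim_L_graded: "dim L = n + 1"
    and h_out: "d \<notin> {k..k + int n} \<Longrightarrow> h d = 0"
    and h_indep: "family_indep {k..k + int n} h"
    and h_L: "h d \<in> L"
    and h_br: "\<exists>c. br (h d) (h e) = sc c (h (d + e))"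
begin

abbreviation "D \<equiv> {k..k + int n}"

text \<open>Zero is homogeneous of every degree, and outside \<open>D\<close> it is the only
  homogeneous vector.\<close>

definition homogeneous :: "int \<Rightarrow> 'a \<Rightarrow> bool" where
  "homogeneous d x \<longleftrightarrow> (\<exists>c. x = sc c (h d))"

lemma homogeneous_h [simp]: "homogeneous d (h d)"
  unfolding homogeneous_def by (intro exI[of _ 1]) simp

lemma homogeneous_scale: "homogeneous d x \<Longrightarrow> homogeneous d (sc c x)"
  by (auto simp: homogeneous_def)

lemma homogeneous_br: "homogeneous d x \<Longrightarrow> homogeneous e y \<Longrightarrow> homogeneous (d + e) (br x y)"
  using h_br[of d e] h_L by (auto simp: homogeneous_def br_scale_left br_scale_right)

lemma h_span: "span (h ` D) = L"
proof -
  obtain A where "finite A" "L = span A" using L_span by metis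
  then show ?thesis by (rule family_indep_spans[OF _ _ _ h_indep]) (use h_L dim_L_graded in auto)
qed

lemma h_expand:
  assumes "x \<in> L" obtains c where "x = (\<Sum>d\<in>D. sc (c d) (h d))"
  using assms h_span span_family_iff[of D x h] by auto

text \<open>Each L^m is a homogeneous subspace. Expanding both factors in \<open>h\<close>, a
  generator of L^(m+1) becomes a combination of products of homogeneous vectors, each of which is a
  multiple of a single \<open>h (d + e)\<close>.\<close>

lemma LC_homogeneous: "LC m \<subseteq> span (h ` {d \<in> D. h d \<in> LC m})"
proof (induction m)
  case 0
  have "{d \<in> D. h d \<in> LC 0} = D" using h_L by auto
  then show ?case using h_span by (metis lcs.simps(1) order_refl)
next
  case (Suc m)
  show ?case
  proof (cases m)
    case 0
    have "{d \<in> D. h d \<in> LC (Suc 0)} = D" using h_L by auto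
    then show ?thesis using h_span 0 by (metis lcs.simps(2) order_refl)
  next
    case (Suc j)
    let ?T = "span (h ` {d \<in> D. h d \<in> LC (Suc m)})"
    let ?A = "{d \<in> D. h d \<in> LC m}"
    have "br a b \<in> ?T" if ab: "a \<in> LC m" "b \<in> L" for a b
    proof -
      have "finite ?A" by (rule finite_subset[of _ D]) auto
      moreover have "a \<in> span (h ` ?A)" using ab Suc.IH by blast
      ultimately obtain c where c: "a = (\<Sum>d\<in>?A. sc (c d) (h d))"
        using span_family_iff[of ?A a h] by blast
      obtain c' where c': "b = (\<Sum>d\<in>D. sc (c' d) (h d))" using h_expand ab by blast
      have "br a b = (\<Sum>d\<in>?A. \<Sum>e\<in>D. br (sc (c d) (h d)) (sc (c' e) (h e)))"
      proof -
        have "br a b = (\<Sum>d\<in>?A. br (sc (c d) (h d)) b)"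
          unfolding c by (rule br_sum_left) (use h_L ab in auto)
        also have "\<dots> = (\<Sum>d\<in>?A. \<Sum>e\<in>D. br (sc (c d) (h d)) (sc (c' e) (h e)))"
          unfolding c' by (rule sum.cong[OF refl], rule br_sum_right) (use h_L in auto)
        finally show ?thesis .
      qed
      also have "\<dots> \<in> ?T"
      proof (intro span_sum)
        fix d e assume d: "d \<in> ?A" and e: "e \<in> D"
        obtain r where r: "br (h d) (h e) = sc r (h (d + e))" using h_br by blast
        have m: "br (h d) (h e) \<in> LC (Suc m)" using d h_L by (auto intro: LC_br1)
        have "br (h d) (h e) \<in> ?T"
        proof (cases "r = 0 \<or> h (d + e) = 0")
          case True
          then show ?thesis using r by (auto simp: span_zero)
        next
          case False
          \<comment> \<open>A nonzero product can be divided by its scalar, so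
            \<open>h (d + e)\<close> itself belongs to L^(m+1).\<close>
          have "h (d + e) = sc (1 / r) (br (h d) (h e))" using False r by simp
          then have "h (d + e) \<in> LC (Suc m)" using m by simp
          moreover have "d + e \<in> D" using False h_out by blast
          ultimately show ?thesis unfolding r by (intro span_scale span_base) auto
        qed
        then show "br (sc (c d) (h d)) (sc (c' e) (h e)) \<in> ?T"
          using h_L by (simp add: br_scale_left br_scale_right span_scale)
      qed
      finally show ?thesis .
    qed
    then have "span {br a b | a b. a \<in> LC m \<and> b \<in> L} \<subseteq> ?T" by (intro span_minimal) auto
    then show ?thesis using Suc by simp
  qed
qed

text \<open>A homogeneous subspace contains the homogeneous components of its elements. This turns
  one relation modulo L^m between products of different degrees into two.\<close>

lemma homogeneous_separate:
  assumes "homogeneous s x" "homogeneous t y" "s \<noteq> t" "x + y \<in> LC m"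
  shows "x \<in> LC m"
proof (rule ccontr)
  assume n: "x \<notin> LC m"
  obtain p q where pq: "x = sc p (h s)" "y = sc q (h t)" using assms by (auto simp: homogeneous_def)
  let ?A = "{d \<in> D. h d \<in> LC m}"
  have "finite ?A" by (rule finite_subset[of _ D]) auto
  moreover have "x + y \<in> span (h ` ?A)" using assms(4) LC_homogeneous by blast
  ultimately obtain c where c: "x + y = (\<Sum>d\<in>?A. sc (c d) (h d))"
    using span_family_iff[of ?A "x + y" h] by blast
  have "h s \<noteq> 0" using n pq by auto
  then have s: "s \<in> D" using h_out by blast
  have sA: "s \<notin> ?A" using n pq by auto
  \<comment> \<open>Two expansions of \<open>x + y\<close> are compared at \<open>s\<close>: in the
    first the coefficient is 0 because \<open>s\<close> is not in \<open>?A\<close>, in the second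
    it is \<open>p\<close>.\<close>
  have "(\<Sum>d\<in>D. sc (if d \<in> ?A then c d else 0) (h d)) = (\<Sum>d\<in>D. if d \<in> ?A then sc (c d) (h d) else 0)"
    by (rule sum.cong) auto
  also have "\<dots> = x + y" unfolding c by (subst sum.inter_filter[symmetric]) (auto intro: sum.cong)
  finally have 1: "(\<Sum>d\<in>D. sc (if d \<in> ?A then c d else 0) (h d)) = x + y" .
  have "(\<Sum>d\<in>D. sc ((if d = s then p else 0) + (if d = t then q else 0)) (h d)) =
     (\<Sum>d\<in>D. if d = s then x else 0) + (\<Sum>d\<in>D. if d = t then y else 0)"
    unfolding sum.distrib[symmetric] by (rule sum.cong) (auto simp: pq scale_left_distrib)
  also have "\<dots> = x + y" using s pq h_out[of t] by (auto simp: sum.delta)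
  finally have 2: "(\<Sum>d\<in>D. sc ((if d = s then p else 0) + (if d = t then q else 0)) (h d)) = x + y" .
  from family_indep_eq[OF h_indep trans[OF 1 2[symmetric]] s] sA assms(3) have "p = 0" by (auto split: if_splits)
  then show False using n pq by simp
qed

lemma ps_expand:
  "ps 1 (\<Sum>d\<in>D. sc (c d) (h d)) p = (\<Sum>d\<in>D. c d * ps 1 (h d) p)"
  using h_L by (subst ps_sum) (auto simp: ps_scale)

text \<open>Any adapted triple gives the criterion, homogeneous or not. \<open>ps_onto\<close>
  supplies one, so the criterion is available for the construction of homogeneous
  generators.\<close>

lemma lead_LC_Suc_graded:
  assumes "x \<in> LC m" "m \<ge> 1" "\<And>p. p \<in> lead n m \<Longrightarrow> ps m x p = 0"
  shows "x \<in> LC (Suc m)"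
proof -
  obtain U where "U \<in> L" "ps 1 U 1 = 1" using ps_onto[of 1 0 0] by auto
  moreover obtain W where "W \<in> L" "ps 1 W 1 = 0" "ps 1 W (n - 1) = 1" using ps_onto[of 0 1 0] by auto
  moreover obtain Z where "Z \<in> L" "ps 1 Z 1 = 0" "ps 1 Z (n - 1) = 0" "ps 1 Z 0 = 1"
    using ps_onto[of 0 0 1] by auto
  ultimately interpret adapted_triple sc L br n ps U W Z
    by unfold_locales (use dim_L_graded in auto)
  show ?thesis using assms by (rule lead_LC_Suc)
qed

lemma LC_3I:
  assumes "x \<in> LC 2" "ps 2 x 2 = 0" "ps 2 x n = 0" shows "x \<in> LC 3"
  using lead_LC_Suc_graded[OF assms(1)] assms by (auto simp: lead_def eval_nat_numeral)

lemma ps_br_gens: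
  assumes "x \<in> L" "y \<in> L"
  shows "br x y \<in> LC 2" "ps 2 (br x y) 2 = ps 1 x 1 * ps 1 y 1" "ps 2 (br x y) n = ps 1 x 1 * ps 1 y (n - 1)"
proof -
  have xy: "x \<in> LC 1" "y \<in> LC 1" using assms by simp_all
  show "br x y \<in> LC 2" using LC_br[OF xy] by (simp add: numeral_2_eq_2)
  show "ps 2 (br x y) 2 = ps 1 x 1 * ps 1 y 1" "ps 2 (br x y) n = ps 1 x 1 * ps 1 y (n - 1)"
    using ps_br[OF xy, of 2] ps_br[OF xy, of n] n_ge by (auto simp: numeral_2_eq_2)
qed

text \<open>Write \<lambda> and \<mu> for the coordinates 1 and n-1 in degree 1. The product from
  L/L^2 to L^2/L^3 sends (x,y) to \<lambda>(x) (\<lambda>(y) e_2 + \<mu>(y) e_n). Its left kernel is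
  given by \<lambda> = 0 and its right kernel by \<lambda> = \<mu> = 0. Both are homogeneous, so
  \<lambda> is nonzero on only one \<open>h u\<close>, and among the others \<mu> is nonzero on only
  one \<open>h w\<close>.\<close>

lemma homogeneous_triple:
  obtains u w z where "adapted_triple sc L br n ps (h u) (h w) (h z)"
proof -
  note hL[simp] = h_L
  have "\<exists>u\<in>D. ps 1 (h u) 1 \<noteq> 0"
  proof (rule ccontr)
    assume "\<not> ?thesis"
    moreover obtain x where x: "x \<in> L" "ps 1 x 1 = 1" using ps_onto[of 1 0 0] by auto
    obtain c where "x = (\<Sum>d\<in>D. sc (c d) (h d))" using h_expand x by blast
    ultimately show False using x ps_expand[of c 1] by simp
  qed
  then obtain u where u: "u \<in> D" "ps 1 (h u) 1 \<noteq> 0" by blast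
  \<comment> \<open>The sum of \<open>X\<close> and \<open>Y\<close> is built to vanish in L^2/L^3.
    Its terms have different degrees, so \<open>Y\<close> alone lies in L^3, and its coordinate 2,
    which is -\<lambda>(h_d) \<lambda>(h_u)^2, vanishes.\<close>
  have lam: "ps 1 (h d) 1 = 0" if "d \<noteq> u" for d
  proof -
    define X where "X = sc (ps 1 (h u) 1) (br (h d) (h u))"
    define Y where "Y = sc (- ps 1 (h d) 1) (br (h u) (h u))"
    have "homogeneous (u + u) Y" "homogeneous (d + u) X"
      unfolding X_def Y_def by (intro homogeneous_scale homogeneous_br homogeneous_h)+
    moreover have XY2: "X \<in> LC 2" "Y \<in> LC 2" unfolding X_def Y_def by (intro LC_simps(3) ps_br_gens(1) h_L)+
    moreover have psX: "ps 2 X p = ps 1 (h u) 1 * ps 2 (br (h d) (h u)) p"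
      and psY: "ps 2 Y p = - ps 1 (h d) 1 * ps 2 (br (h u) (h u)) p" for p
      unfolding X_def Y_def by (rule ps_scale, simp add: ps_br_gens)+
    have "Y + X \<in> LC 3"
      by (intro LC_3I) (simp_all add: XY2 ps_add[OF XY2(2,1)] psX psY ps_br_gens)
    ultimately have "Y \<in> LC 3" using homogeneous_separate[of "u + u" Y "d + u" X 3] that by simp
    then have "ps 2 Y 2 = 0" by (intro ps_LC_Suc) (simp add: eval_nat_numeral)
    then show ?thesis using u by (simp add: psY ps_br_gens)
  qed
  have sum_lam: "(\<Sum>d\<in>D. c d * ps 1 (h d) 1) = c u * ps 1 (h u) 1" for c
    using u lam by (subst sum.remove[of D u]) auto
  have "\<exists>w\<in>D. w \<noteq> u \<and> ps 1 (h w) (n - 1) \<noteq> 0"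
  proof (rule ccontr)
    assume neg: "\<not> ?thesis"
    obtain x where x: "x \<in> L" "ps 1 x 1 = 0" "ps 1 x (n - 1) = 1" using ps_onto[of 0 1 0] by auto
    obtain c where c: "x = (\<Sum>d\<in>D. sc (c d) (h d))" using h_expand x by blast
    have "c u = 0" using x ps_expand[of c 1] sum_lam c u by simp
    then have "c d * ps 1 (h d) (n - 1) = 0" if "d \<in> D" for d using neg that by auto
    then have "(\<Sum>d\<in>D. c d * ps 1 (h d) (n - 1)) = 0" by (intro sum.neutral) auto
    then show False using x ps_expand[of c "n - 1"] c by simp
  qed
  then obtain w where w: "w \<in> D" "w \<noteq> u" "ps 1 (h w) (n - 1) \<noteq> 0" by blast
  \<comment> \<open>The same separation for right factors, with \<open>h u\<close> on the left.
    Since \<lambda> vanishes on \<open>h d\<close> and \<open>h w\<close>, only coordinate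
    \<open>n\<close> has to cancel.\<close>
  have mu: "ps 1 (h d) (n - 1) = 0" if "d \<noteq> u" "d \<noteq> w" for d
  proof -
    define X where "X = sc (ps 1 (h w) (n - 1)) (br (h u) (h d))"
    define Y where "Y = sc (- ps 1 (h d) (n - 1)) (br (h u) (h w))"
    have "homogeneous (u + w) Y" "homogeneous (u + d) X"
      unfolding X_def Y_def by (intro homogeneous_scale homogeneous_br homogeneous_h)+
    moreover have XY2: "X \<in> LC 2" "Y \<in> LC 2" unfolding X_def Y_def by (intro LC_simps(3) ps_br_gens(1) h_L)+
    moreover have psX: "ps 2 X p = ps 1 (h w) (n - 1) * ps 2 (br (h u) (h d)) p"
      and psY: "ps 2 Y p = - ps 1 (h d) (n - 1) * ps 2 (br (h u) (h w)) p" for p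
      unfolding X_def Y_def by (rule ps_scale, simp add: ps_br_gens)+
    have "Y + X \<in> LC 3"
      using lam[OF that(1)] lam[OF w(2)]
      by (intro LC_3I) (simp_all add: XY2 ps_add[OF XY2(2,1)] psX psY ps_br_gens)
    ultimately have "Y \<in> LC 3" using homogeneous_separate[of "u + w" Y "u + d" X 3] that by simp
    then have "ps 2 Y n = 0" by (intro ps_LC_Suc) (simp add: eval_nat_numeral)
    then show ?thesis using u w by (simp add: psY ps_br_gens)
  qed
  have sum_mu: "(\<Sum>d\<in>D. c d * ps 1 (h d) (n - 1)) = c w * ps 1 (h w) (n - 1)" if "c u = 0" for c
  proof -
    have "c d * ps 1 (h d) (n - 1) = 0" if "d \<in> D - {w}" for d
      using mu[of d] \<open>c u = 0\<close> that by (cases "d = u") auto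
    then have "(\<Sum>d\<in>D - {w}. c d * ps 1 (h d) (n - 1)) = 0" by (intro sum.neutral) blast
    then show ?thesis
      using sum.remove[of D w "\<lambda>d. c d * ps 1 (h d) (n - 1)", OF _ w(1)] by simp
  qed
  \<comment> \<open>An element with coordinates (0,0,1) cannot involve \<open>h u\<close> or
    \<open>h w\<close>, so some other \<open>h z\<close> carries coordinate 0.\<close>
  have "\<exists>z\<in>D. z \<noteq> u \<and> z \<noteq> w \<and> ps 1 (h z) 0 \<noteq> 0"
  proof (rule ccontr)
    assume neg: "\<not> ?thesis"
    obtain x where x: "x \<in> L" "ps 1 x 1 = 0" "ps 1 x (n - 1) = 0" "ps 1 x 0 = 1"
      using ps_onto[of 0 0 1] by auto
    obtain c where c: "x = (\<Sum>d\<in>D. sc (c d) (h d))" using h_expand x by blast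
    have cu: "c u = 0" using x ps_expand[of c 1] sum_lam c u by simp
    have cw: "c w = 0" using x ps_expand[of c "n - 1"] sum_mu[of c, OF cu] c w by simp
    have "c d * ps 1 (h d) 0 = 0" if "d \<in> D" for d using neg that cu cw by auto
    then have "(\<Sum>d\<in>D. c d * ps 1 (h d) 0) = 0" by (intro sum.neutral) auto
    then show False using x ps_expand[of c 0] c by simp
  qed
  then obtain z where z: "z \<in> D" "z \<noteq> u" "z \<noteq> w" "ps 1 (h z) 0 \<noteq> 0" by blast
  have "adapted_triple sc L br n ps (h u) (h w) (h z)"
    by unfold_locales (use u w z lam mu dim_L_graded in auto)
  then show ?thesis by (rule that)
qed

end

section \<open>Products in a homogeneous adapted basis\<close>

lemma (in vector_space) family_indep_reindex:
  assumes "finite J" "inj_on f I" "f ` I \<subseteq> J" "family_indep J b" "\<And>i. i \<in> I \<Longrightarrow> b' i = b (f i)"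
  shows "family_indep I b'"
  unfolding family_indep_def
proof (intro allI impI ballI)
  fix c i assume s: "(\<Sum>i\<in>I. scale (c i) (b' i)) = 0" and i: "i \<in> I"
  define c' where "c' j = (if j \<in> f ` I then c (inv_into I f j) else 0)" for j
  have "(\<Sum>j\<in>J. scale (c' j) (b j)) = (\<Sum>j\<in>f ` I. scale (c' j) (b j))"
    by (rule sum.mono_neutral_right) (use assms in \<open>auto simp: c'_def\<close>)
  also have "\<dots> = (\<Sum>i\<in>I. scale (c' (f i)) (b (f i)))" by (simp add: sum.reindex[OF assms(2)])
  also have "\<dots> = (\<Sum>i\<in>I. scale (c i) (b' i))"
    by (rule sum.cong) (use assms in \<open>auto simp: c'_def\<close>)
  finally have "c' (f i) = 0" using s i assms(3) family_indepD[OF assms(4)] by auto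
  then show "c i = 0" using i assms(2) by (simp add: c'_def)
qed

text \<open>The index set is {1..2} because \<open>standard_algebra\<close> numbers its summands
  from 1.\<close>

lemma (in complex_vector_space) direct_sum_two:
  assumes fin: "finite I" "finite J" and disj: "I \<inter> J = {}" and indep: "family_indep (I \<union> J) b"
  shows "is_direct_sum scale (span (b ` (I \<union> J))) {1..2::nat} (\<lambda>i. if i = 1 then span (b ` I) else span (b ` J))"
  unfolding is_direct_sum_def
proof (intro conjI ballI)
  have two: "{1..2::nat} = {1, 2}" by auto
  let ?N = "\<lambda>i::nat. if i = 1 then span (b ` I) else span (b ` J)"
  fix x assume "x \<in> span (b ` (I \<union> J))"
  then obtain c where c: "x = (\<Sum>i\<in>I \<union> J. scale (c i) (b i))"
    using span_family_iff[of "I \<union> J" x b] fin by auto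
  define p q where "p = (\<Sum>i\<in>I. scale (c i) (b i))" and "q = (\<Sum>i\<in>J. scale (c i) (b i))"
  have x: "x = p + q" unfolding c p_def q_def by (rule sum.union_disjoint) (use fin disj in auto)
  have pq: "p \<in> span (b ` I)" "q \<in> span (b ` J)"
    unfolding p_def q_def using fin span_family_iff by blast+
  show "\<exists>!v. v \<in> (\<Pi>\<^sub>E i\<in>{1..2::nat}. ?N i) \<and> x = (\<Sum>i\<in>{1..2::nat}. v i)"
  proof (rule ex1I[of _ "restrict (\<lambda>i. if i = 1 then p else q) {1..2::nat}"])
    show "restrict (\<lambda>i. if i = 1 then p else q) {1..2::nat} \<in> (\<Pi>\<^sub>E i\<in>{1..2::nat}. ?N i) \<and>
        x = (\<Sum>i\<in>{1..2::nat}. restrict (\<lambda>i. if i = 1 then p else q) {1..2::nat} i)"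
      using pq x unfolding two by simp
  next
    fix v assume v: "v \<in> (\<Pi>\<^sub>E i\<in>{1..2::nat}. ?N i) \<and> x = (\<Sum>i\<in>{1..2::nat}. v i)"
    have "v i \<in> ?N i" if "i \<in> {1..2}" for i using PiE_mem[OF conjunct1[OF v] that] .
    from this[of 1] this[of 2] have v12: "v 1 \<in> span (b ` I)" "v 2 \<in> span (b ` J)" by simp_all
    from v12(1) obtain c1 where c1: "v 1 = (\<Sum>i\<in>I. scale (c1 i) (b i))" using span_family_iff fin by blast
    from v12(2) obtain c2 where c2: "v 2 = (\<Sum>i\<in>J. scale (c2 i) (b i))" using span_family_iff fin by blast
    let ?c = "\<lambda>i. if i \<in> I then c1 i else c2 i"
    have J: "i \<notin> I" if "i \<in> J" for i using that disj by blast
    have "(\<Sum>i\<in>I \<union> J. scale (?c i) (b i)) = (\<Sum>i\<in>I. scale (?c i) (b i)) + (\<Sum>i\<in>J. scale (?c i) (b i))"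
      by (rule sum.union_disjoint) (use fin disj in auto)
    also have "\<dots> = v 1 + v 2" unfolding c1 c2 using J by simp
    also have "\<dots> = x" using v unfolding two by simp
    finally have "?c i = c i" if "i \<in> I \<union> J" for i using family_indep_eq[OF indep _ that, of ?c c] c by simp
    then have "c1 i = c i" if "i \<in> I" for i using that by fastforce
    moreover have "c2 i = c i" if "i \<in> J" for i using \<open>\<And>i. i \<in> I \<union> J \<Longrightarrow> ?c i = c i\<close>[of i] that J[OF that] by simp
    ultimately have "v 1 = p" "v 2 = q" unfolding c1 c2 p_def q_def by simp_all
    then show "v = restrict (\<lambda>i. if i = 1 then p else q) {1..2::nat}"
    proof (intro extensionalityI[of v "{1..2::nat}"])
      fix i :: nat assume "i \<in> {1..2}"
      then have "i = 1 \<or> i = 2" by auto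
      then show "v i = restrict (\<lambda>i. if i = 1 then p else q) {1..2::nat} i"
        using \<open>v 1 = p\<close> \<open>v 2 = q\<close> by auto
    qed (use v in \<open>auto simp: PiE_iff\<close>)
  qed
qed (auto intro!: span_mono)

text \<open>A basis with structure constants \<open>P\<close> determines the algebra. Vanishing of
  \<open>P\<close> outside \<open>I\<close> keeps products of the table inside its carrier.\<close>

lemma (in leib) alg_isomorphic_table:
  assumes fin: "finite I" and indep: "family_indep I b" and spn: "span (b ` I) = L"
    and P: "\<And>e f g. g \<notin> I \<Longrightarrow> P e f g = 0"
    and prods: "\<And>e f. e \<in> I \<Longrightarrow> f \<in> I \<Longrightarrow> br (b e) (b f) = (\<Sum>g\<in>I. sc (P e f g) (b g))"
  shows "alg_isomorphic (alg_of sc L br) (table_alg I P)"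
proof -
  let ?T = "table_alg I P"
  have T: "alg_carrier ?T = {f. \<forall>b. b \<notin> I \<longrightarrow> f b = 0}" "alg_add ?T f g = (\<lambda>b. f b + g b)"
    "alg_scale ?T c f = (\<lambda>b. c * f b)" "alg_prod ?T f g = (\<lambda>d. \<Sum>a\<in>I. \<Sum>b\<in>I. f a * g b * P a b d)" for f g c
    by (auto simp: table_alg_def)
  have bL: "b e \<in> L" if "e \<in> I" for e using spn span_base[of "b e" "b ` I"] that by auto
  \<comment> \<open>The map from coordinates to vectors is given by a formula, so linearity and
    multiplicativity are checked on it and transferred to its inverse \<open>\<phi>\<close>.\<close>
  define \<theta> where "\<theta> f = (\<Sum>e\<in>I. sc (f e) (b e))" for f
  have inj: "inj_on \<theta> (alg_carrier ?T)"
  proof (rule inj_onI)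
    fix f g assume f: "f \<in> alg_carrier ?T" and g: "g \<in> alg_carrier ?T" and eq: "\<theta> f = \<theta> g"
    show "f = g"
    proof
      fix e
      show "f e = g e"
        using f g family_indep_eq[OF indep eq[unfolded \<theta>_def]] by (cases "e \<in> I") (auto simp: T)
    qed
  qed
  have img: "\<theta> ` alg_carrier ?T = L"
  proof
    show "\<theta> ` alg_carrier ?T \<subseteq> L" unfolding \<theta>_def using bL by (auto intro!: L_sum)
    show "L \<subseteq> \<theta> ` alg_carrier ?T"
    proof
      fix x assume "x \<in> L"
      then obtain c where "x = (\<Sum>e\<in>I. sc (c e) (b e))" using span_family_iff[OF fin, of x b] spn by auto
      then have "x = \<theta> (\<lambda>e. if e \<in> I then c e else 0)" by (simp add: \<theta>_def)
      moreover have "(\<lambda>e. if e \<in> I then c e else 0) \<in> alg_carrier ?T" by (simp add: T)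
      ultimately show "x \<in> \<theta> ` alg_carrier ?T" by blast
    qed
  qed
  define \<phi> where "\<phi> = inv_into (alg_carrier ?T) \<theta>"
  have bij: "bij_betw \<phi> L (alg_carrier ?T)"
    unfolding \<phi>_def by (rule bij_betw_inv_into) (use inj img in \<open>simp add: bij_betw_def\<close>)
  have \<phi>\<theta>: "\<phi> (\<theta> f) = f" if "f \<in> alg_carrier ?T" for f unfolding \<phi>_def using inj that by (rule inv_into_f_f)
  have \<theta>\<phi>: "\<phi> x \<in> alg_carrier ?T" "\<theta> (\<phi> x) = x" if "x \<in> L" for x
    using that img unfolding \<phi>_def by (simp_all add: inv_into_into f_inv_into_f)
  have hom: "\<phi> (\<theta> f) = g" if "\<theta> f = \<theta> g" "g \<in> alg_carrier ?T" for f g using that \<phi>\<theta> by simp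
  have add: "\<phi> (x + y) = alg_add ?T (\<phi> x) (\<phi> y)" if "x \<in> L" "y \<in> L" for x y
  proof -
    have "\<theta> (alg_add ?T (\<phi> x) (\<phi> y)) = \<theta> (\<phi> x) + \<theta> (\<phi> y)"
      by (simp add: \<theta>_def T scale_left_distrib sum.distrib)
    moreover have "alg_add ?T (\<phi> x) (\<phi> y) \<in> alg_carrier ?T" using \<theta>\<phi>(1) that by (simp add: T)
    ultimately show ?thesis using \<phi>\<theta> \<theta>\<phi>(2) that by metis
  qed
  have scl: "\<phi> (sc c x) = alg_scale ?T c (\<phi> x)" if "x \<in> L" for c x
  proof -
    have "\<theta> (alg_scale ?T c (\<phi> x)) = sc c (\<theta> (\<phi> x))"
      by (simp add: \<theta>_def T scale_sum_right)
    moreover have "alg_scale ?T c (\<phi> x) \<in> alg_carrier ?T" using \<theta>\<phi>(1) that by (simp add: T)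
    ultimately show ?thesis using \<phi>\<theta> \<theta>\<phi>(2) that by metis
  qed
  have prd: "\<phi> (br x y) = alg_prod ?T (\<phi> x) (\<phi> y)" if "x \<in> L" "y \<in> L" for x y
  proof -
    have "br (\<theta> f) (\<theta> g) = \<theta> (alg_prod ?T f g)" for f g
    proof -
      have "br (\<theta> f) (\<theta> g) = (\<Sum>a\<in>I. br (sc (f a) (b a)) (\<theta> g))"
        unfolding \<theta>_def by (rule br_sum_left) (use bL in \<open>auto intro!: L_sum\<close>)
      also have "\<dots> = (\<Sum>a\<in>I. \<Sum>e\<in>I. br (sc (f a) (b a)) (sc (g e) (b e)))"
        unfolding \<theta>_def by (rule sum.cong[OF refl], rule br_sum_right) (use bL in auto)
      also have "\<dots> = (\<Sum>a\<in>I. \<Sum>e\<in>I. \<Sum>d\<in>I. sc (f a * g e * P a e d) (b d))"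
        using bL prods by (intro sum.cong refl) (simp add: br_scale_left br_scale_right scale_sum_right mult_ac)
      also have "\<dots> = (\<Sum>a\<in>I. \<Sum>d\<in>I. \<Sum>e\<in>I. sc (f a * g e * P a e d) (b d))"
        by (rule sum.cong[OF refl], rule sum.swap)
      also have "\<dots> = (\<Sum>d\<in>I. \<Sum>a\<in>I. \<Sum>e\<in>I. sc (f a * g e * P a e d) (b d))"
        by (rule sum.swap)
      also have "\<dots> = \<theta> (alg_prod ?T f g)"
        by (simp add: \<theta>_def T scale_sum_left)
      finally show ?thesis .
    qed
    then have "br x y = \<theta> (alg_prod ?T (\<phi> x) (\<phi> y))" using \<theta>\<phi>(2) that by metis
    moreover have "alg_prod ?T (\<phi> x) (\<phi> y) \<in> alg_carrier ?T" by (simp add: T P)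
    ultimately show ?thesis using \<phi>\<theta> by simp
  qed
  show ?thesis
    unfolding alg_isomorphic_def
    by (rule exI[of _ \<phi>]) (use bij add scl prd in \<open>simp add: alg_of_def\<close>)
qed

section \<open>Degrees of the basis and the candidate products\<close>

definition basis_degree :: "nat \<Rightarrow> int \<Rightarrow> int \<Rightarrow> int \<Rightarrow> basis_elt \<Rightarrow> int" where
  "basis_degree n u w z e = (case e of
     Y i \<Rightarrow> if i \<le> n - 2 then int i * u else if i = n - 1 then w else u + w | Z1 \<Rightarrow> z)"

text \<open>A common form of all outcomes: (0,1) gives M, (1,\<alpha>) gives M^{1,\<alpha>}, and
  (0,0) gives \<open>KF4\<close> plus a line.\<close>

definition WZ_prod :: "nat \<Rightarrow> complex \<Rightarrow> complex \<Rightarrow> basis_elt \<Rightarrow> basis_elt \<Rightarrow> basis_elt \<Rightarrow> complex" where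
  "WZ_prod n \<alpha> \<beta> a b = (case (a, b) of
       (Y i, Y j) \<Rightarrow>
         (if j = 1 \<and> 1 \<le> i \<and> i \<le> n - 3 then unit_vec_at (Y (i + 1))
          else if i = 1 \<and> j = n - 1 then unit_vec_at (Y n)
          else (\<lambda>_. 0))
     | (Y i, Z1) \<Rightarrow> (if i = n - 1 then (\<lambda>d. \<alpha> * unit_vec_at (Y (n - 2)) d) else (\<lambda>_. 0))
     | (Z1, Y j) \<Rightarrow> (if j = n - 1 then (\<lambda>d. \<beta> * unit_vec_at (Y (n - 2)) d) else (\<lambda>_. 0))
     | _ \<Rightarrow> (\<lambda>_. 0))"

lemma WZ_prod_support:
  "WZ_prod n \<alpha> \<beta> e f g \<noteq> 0 \<Longrightarrow> g = Y n \<or> g = Y (n - 2) \<or> (\<exists>i. g = Y (i + 1) \<and> i \<le> n - 3)"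
  by (cases e; cases f) (simp_all add: WZ_prod_def unit_vec_at_def split: if_splits)

lemma M_alg_eq: "M_alg n = table_alg (basis_YZ n) (WZ_prod n 0 1)"
proof -
  have "M_prod n = WZ_prod n 0 1"
    by (intro ext) (auto simp: M_prod_def WZ_prod_def split: basis_elt.splits)
  then show ?thesis by (simp add: M_alg_def)
qed

lemma M1_alg_eq: "M1_alg n \<alpha> = table_alg (basis_YZ n) (WZ_prod n 1 \<alpha>)"
proof -
  have "M1_prod n \<alpha> = WZ_prod n 1 \<alpha>"
    by (intro ext) (auto simp: M1_prod_def WZ_prod_def split: basis_elt.splits)
  then show ?thesis by (simp add: M1_alg_def)
qed

text \<open>This is the case u = 1. Powers of U occupy the degrees 1..N-2, so w, 1+w and z lie below
  1 or above N-2. Two powers gain no level, and neither does a power with a degree below; a power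
  with a degree above overshoots N-2. Two degrees on the same side give a sum at most 0 or above
  N-2. With one degree on each side, the distance bounds leave only w = -1 and z = N-1, whose sum is
  N-2.\<close>

lemma degree_arith:
  fixes N w z m a b la lb :: int
  assumes "N \<ge> 7" "3 \<le> m" "m \<le> N - 2"
    and "w < 1 \<or> w > N - 2" "1 + w < 1 \<or> 1 + w > N - 2" "z < 1 \<or> z > N - 2"
    and "\<bar>w - z\<bar> \<le> N" "\<bar>1 + w - z\<bar> \<le> N" "\<bar>w - 1\<bar> \<le> N" "\<bar>1 + w - 1\<bar> \<le> N"
      "\<bar>z - 1\<bar> \<le> N" "\<bar>w - (N - 2)\<bar> \<le> N" "\<bar>z - (N - 2)\<bar> \<le> N"
    and "w \<noteq> z" "1 + w \<noteq> z"
    and "m = a + b" "la + lb < m"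
    and "(la = a \<and> 1 \<le> a \<and> a \<le> N - 2) \<or> (la = 1 \<and> a = w) \<or> (la = 2 \<and> a = 1 + w) \<or> (la = 1 \<and> a = z)"
    and "(lb = b \<and> 1 \<le> b \<and> b \<le> N - 2) \<or> (lb = 1 \<and> b = w) \<or> (lb = 2 \<and> b = 1 + w) \<or> (lb = 1 \<and> b = z)"
  shows "m = N - 2 \<and> (a = w \<and> b = z \<or> a = z \<and> b = w)"
  using assms by smt

section \<open>Degrees against levels in a homogeneous adapted basis\<close>

locale graded_triple =
  graded_KF4 sc L br n ps k h + adapted_triple sc L br n ps U W Z
  for sc :: "complex \<Rightarrow> 'a::ab_group_add \<Rightarrow> 'a" and L br n ps k h U W Z +
  fixes u w z :: int
  assumes homogeneous_gens: "homogeneous u U" "homogeneous w W" "homogeneous z Z"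
begin

abbreviation "deg \<equiv> basis_degree n u w z"

lemma deg_simps:
  "i \<le> n - 2 \<Longrightarrow> deg (Y i) = int i * u" "deg (Y (n - 1)) = w" "deg (Y n) = u + w" "deg Z1 = z"
  using n_ge by (auto simp: basis_degree_def)

lemma homogeneous_rpow: "i \<ge> 1 \<Longrightarrow> homogeneous (int i * u) (rpow U i)"
proof (induction i rule: nat_induct_at_least)
  case base
  then show ?case using homogeneous_gens by simp
next
  case (Suc i)
  then show ?case using homogeneous_br[OF Suc.IH homogeneous_gens(1)]
    by (simp add: rpow_Suc algebra_simps)
qed

lemma homogeneous_B:
  assumes "e \<in> E" shows "homogeneous (deg e) (B e)"
proof -
  consider i where "e = Y i" "1 \<le> i" "i \<le> n - 2" | "e = Y (n - 1)" | "e = Y n" | "e = Z1"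
    using level_cases[OF assms] by blast
  then show ?thesis
    by cases (use homogeneous_rpow homogeneous_gens homogeneous_br[OF homogeneous_gens(1,2)]
      in \<open>simp_all only: deg_simps B_simps\<close>)
qed

lemma B_nonzero: "e \<in> E \<Longrightarrow> B e \<noteq> 0"
  using family_indep_nonzero[OF finite_basis_YZ B_indep] .

lemma B_eq_h:
  assumes "e \<in> E" obtains c where "c \<noteq> 0" "B e = sc c (h (deg e))" "h (deg e) \<noteq> 0"
  using homogeneous_B[OF assms] B_nonzero[OF assms] unfolding homogeneous_def by auto

lemma deg_D: "e \<in> E \<Longrightarrow> deg e \<in> D"
  using B_eq_h h_out by metis

text \<open>Two basis vectors of equal degree would be multiples of the same \<open>h d\<close>,
  hence proportional.\<close>

lemma deg_inj: "inj_on deg E"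
proof (rule inj_onI, rule ccontr)
  fix e f assume ef: "e \<in> E" "f \<in> E" "deg e = deg f" "e \<noteq> f"
  obtain c where c: "c \<noteq> 0" "B e = sc c (h (deg e))" using B_eq_h[OF ef(1)] by metis
  obtain c' where c': "c' \<noteq> 0" "B f = sc c' (h (deg f))" using B_eq_h[OF ef(2)] by metis
  have "sc c' (B e) = sc c (B f)" unfolding c c' ef(3) by (simp add: mult.commute)
  from family_indep_not_proportional[OF finite_basis_YZ B_indep ef(1,2,4) this] c'
  show False by simp
qed

lemma deg_surj: "deg ` E = D"
  by (rule card_subset_eq) (use deg_D card_image[OF deg_inj] in auto)

text \<open>The n+1 distinct degrees exhaust \<open>D\<close>, so each homogeneous line is spanned
  by one basis vector.\<close>

lemma homogeneous_imp_B:
  assumes "homogeneous d x" "x \<noteq> 0"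
  obtains e c where "e \<in> E" "deg e = d" "x = sc c (B e)"
proof -
  obtain a where a: "x = sc a (h d)" using assms by (auto simp: homogeneous_def)
  then have "h d \<noteq> 0" using assms by auto
  then have "d \<in> D" using h_out by blast
  then obtain e where e: "e \<in> E" "deg e = d" using deg_surj by (metis imageE)
  obtain c where "c \<noteq> 0" "B e = sc c (h d)" using B_eq_h[OF e(1)] e(2) by metis
  then have "x = sc (a / c) (B e)" using a by simp
  then show ?thesis using that e by blast
qed

text \<open>Together with \<open>B_LC\<close>, this makes the level the exact depth of the basis
  vector.\<close>

lemma B_LC_level:
  assumes "e \<in> E" "B e \<in> LC m" shows "m \<le> lev e"
proof (rule ccontr)
  assume "\<not> m \<le> lev e"
  moreover have "(\<Sum>f\<in>E. sc (if f = e then 1 else 0) (B f)) = (\<Sum>f\<in>E. if f = e then B e else 0)"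
    by (rule sum.cong) auto
  then have "(\<Sum>f\<in>E. sc (if f = e then 1 else 0) (B f)) = B e" using assms(1) by simp
  ultimately show False using coeff_LC[of "\<lambda>f. if f = e then 1 else 0" m e] assms by simp
qed

lemma level_1_cases:
  assumes "e \<in> E" "\<not> 2 \<le> lev e" shows "e = Y 1 \<or> e = Y (n - 1) \<or> e = Z1"
proof -
  have "e \<in> {e \<in> E. lev e = 1}" using assms level_pos[OF assms(1)] by simp
  then show ?thesis unfolding level_eq_set by simp
qed

lemma ps_B_1: "e \<in> E \<Longrightarrow> e \<noteq> Y 1 \<Longrightarrow> ps (lev e) (B e) 1 = 0"
proof (cases "lev e \<ge> 2")
  case True
  assume "e \<in> E"
  then show ?thesis using True by (intro ps_vanish B_LC) auto
next
  case False
  assume e: "e \<in> E" "e \<noteq> Y 1"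
  then have "e = Y (n - 1) \<or> e = Z1" using level_1_cases[OF e(1)] False by auto
  then show ?thesis using ps_W ps_Z n_ge by auto
qed

lemma ps_B_n1: "e \<in> E \<Longrightarrow> e \<noteq> Y 1 \<Longrightarrow> e \<noteq> Y (n - 1) \<Longrightarrow> ps (lev e) (B e) (n - 1) = 0"
proof (cases "lev e \<ge> 2")
  case True
  assume "e \<in> E"
  then show ?thesis using True by (intro ps_vanish B_LC) auto
next
  case False
  assume e: "e \<in> E" "e \<noteq> Y 1" "e \<noteq> Y (n - 1)"
  then have "e = Z1" using level_1_cases[OF e(1)] False by auto
  then show ?thesis using ps_Z by auto
qed

text \<open>The graded product has two sources of coordinates: a right factor with coordinate 1, or
  a left factor with coordinate 1 and a right factor with coordinate n-1. The excluded pairs are the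
  only ones that produce a leading coordinate. A possible coordinate n-1 of U matters only in [U,U],
  which is one of them.\<close>

lemma ps_lead_prod:
  assumes e: "e \<in> E" and f: "f \<in> E"
    and ne: "\<not> (f = Y 1 \<and> (\<exists>i\<le>n - 3. e = Y i))" "\<not> (e = Y 1 \<and> f = Y (n - 1))"
    and p: "p \<in> lead n (lev e + lev f)"
  shows "ps (lev e + lev f) (br (B e) (B f)) p = 0"
proof -
  have "ps (lev e) (B e) (p - 1) * ps (lev f) (B f) 1 = 0" if p2: "2 \<le> p" "p \<le> n - 2"
  proof (cases "f = Y 1")
    case True
    have lf: "lev f = 1" using True n_ge by simp
    \<comment> \<open>Below n-1, the only leading coordinate of degree \<open>lev e + 1\<close> is
      that number itself. This rules out powers of U for \<open>e\<close>: the smaller exponents are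
      excluded by \<open>ne\<close>, and the exponent n-2 would give p = n-1.\<close>
    have pe: "p = lev e + 1" using p p2 level_pos[OF e] n_ge unfolding lf lead_def by (auto split: if_splits)
    have "e = Y (n - 1) \<or> e = Y n \<or> e = Z1"
      using level_cases[OF e] ne(1) True pe p2 by (auto; presburger)
    then have "ps (lev e) (B e) (p - 1) = 0"
      using ps_W ps_Z ps_UW n_ge by (auto simp: pe)
    then show ?thesis by simp
  next
    case False
    then show ?thesis using ps_B_1[OF f] by simp
  qed
  moreover have "ps (lev e) (B e) 1 * ps (lev f) (B f) (n - 1) = 0"
  proof (cases "e = Y 1")
    case True
    then have "f \<noteq> Y 1" "f \<noteq> Y (n - 1)" using ne n_ge by auto
    then show ?thesis using ps_B_n1[OF f] by simp
  next
    case False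
    then show ?thesis using ps_B_1[OF e] by simp
  qed
  ultimately show ?thesis using ps_br[OF B_LC[OF e] B_LC[OF f], of p] by auto
qed

text \<open>A product not visible in gr falls at least one step deeper than expected; being
  homogeneous, it is a multiple of a single basis vector, whose level is therefore too
  large.\<close>

lemma prod_level:
  assumes e: "e \<in> E" and f: "f \<in> E"
    and ne: "\<not> (f = Y 1 \<and> (\<exists>i\<le>n - 3. e = Y i))" "\<not> (e = Y 1 \<and> f = Y (n - 1))"
    and nz: "br (B e) (B f) \<noteq> 0"
  obtains g c where "g \<in> E" "deg g = deg e + deg f" "br (B e) (B f) = sc c (B g)" "lev e + lev f < lev g"
proof -
  have "br (B e) (B f) \<in> LC (lev e + lev f)" by (intro LC_br B_LC e f)
  then have LC: "br (B e) (B f) \<in> LC (Suc (lev e + lev f))"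
    using lead_LC_Suc ps_lead_prod[OF e f ne] level_pos[OF e] by simp
  obtain g c where g: "g \<in> E" "deg g = deg e + deg f" "br (B e) (B f) = sc c (B g)"
    using homogeneous_imp_B[OF homogeneous_br[OF homogeneous_B[OF e] homogeneous_B[OF f]] nz] .
  have "c \<noteq> 0" using g nz by auto
  then have "B g = sc (1 / c) (br (B e) (B f))" using g by simp
  then have "B g \<in> LC (Suc (lev e + lev f))" using LC by simp
  then have "lev e + lev f < lev g" using B_LC_level[OF g(1)] Suc_le_lessD by blast
  then show ?thesis using that g by blast
qed

lemma deg_level:
  assumes n: "n \<noteq> 5" "n \<noteq> 6" and E: "e \<in> E" "f \<in> E" "g \<in> E"
    and deg: "deg g = deg e + deg f" and lev: "lev e + lev f < lev g"
  shows "g = Y (n - 2) \<and> (e = Y (n - 1) \<and> f = Z1 \<or> e = Z1 \<and> f = Y (n - 1))"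
proof -
  \<comment> \<open>The factors have level at least 1, so \<open>g\<close> has level at least 3 and
    is a power of U. This forces n \<ge> 5, hence n \<ge> 7; for n = 4 there is no such
    \<open>g\<close>.\<close>
  obtain m where m: "g = Y m" "m \<le> n - 2" "lev g = m" "3 \<le> m"
    using level_cases[OF E(3)] lev level_pos[OF E(1)] level_pos[OF E(2)] by auto
  have n7: "n \<ge> 7" using m n by simp
  have dist: "\<bar>deg a - deg b\<bar> \<le> int n" if "a \<in> E" "b \<in> E" for a b
    using deg_D[OF that(1)] deg_D[OF that(2)] by auto
  have inj: "a = b" if "deg a = deg b" "a \<in> E" "b \<in> E" for a b
    using deg_inj that by (auto simp: inj_on_def)
  have u0: "u \<noteq> 0"
  proof
    assume "u = 0"
    then have "Y 1 = Y 2" using n7 using deg_simps(1)[of 1] deg_simps(1)[of 2] by (intro inj) auto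
    then show False by simp
  qed
  \<comment> \<open>U and U^(n-2) are (n-3)|u| degrees apart, within an interval of length n. For
    |u| \<ge> 2 this would give 2(n-3) \<le> n, which is false for n \<ge> 7.\<close>
  have "\<bar>u\<bar> \<le> 1"
  proof (rule ccontr)
    assume "\<not> \<bar>u\<bar> \<le> 1"
    then have u2: "2 \<le> \<bar>u\<bar>" by simp
    have "deg (Y (n - 2)) - deg (Y 1) = (int n - 3) * u"
      using n7 by (simp add: deg_simps of_nat_diff algebra_simps)
    moreover have "\<bar>deg (Y (n - 2)) - deg (Y 1)\<bar> \<le> int n" using n7 by (intro dist) auto
    ultimately have "(int n - 3) * \<bar>u\<bar> \<le> int n" using n7 by (simp add: abs_mult)
    moreover have "(int n - 3) * 2 \<le> (int n - 3) * \<bar>u\<bar>" using u2 n7 by (intro mult_left_mono) auto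
    ultimately have "(int n - 3) * 2 \<le> int n" by linarith
    then show False using n7 by presburger
  qed
  then have u1: "u = 1 \<or> u = - 1" using u0 by linarith
  then have uu: "u * u = 1" by auto
  \<comment> \<open>Multiplying all degrees by u = 1 or -1 reduces to the case u = 1.\<close>
  define d where "d e = u * deg e" for e
  define w' z' where "w' = u * w" and "z' = u * z"
  have d_simps: "i \<le> n - 2 \<Longrightarrow> d (Y i) = int i" "d (Y (n - 1)) = w'" "d (Y n) = 1 + w'" "d Z1 = z'" for i
    unfolding d_def w'_def z'_def using uu
    by (simp_all only: deg_simps distrib_left mult.left_commute[of u "int i"] mult_1_right)
  have d_dist: "\<bar>d a - d b\<bar> \<le> int n" if "a \<in> E" "b \<in> E" for a b
    using dist[OF that] u1 by (auto simp: d_def)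
  have d_inj: "a = b" if "d a = d b" "a \<in> E" "b \<in> E" for a b
    using inj[OF _ that(2,3)] u0 that(1) by (simp add: d_def)
  \<comment> \<open>Degrees are distinct and the powers already use 1..n-2.\<close>
  have gap: "d a < 1 \<or> d a > int n - 2" if "a \<in> E" "a = Y (n - 1) \<or> a = Y n \<or> a = Z1" for a
  proof (rule ccontr)
    assume "\<not> ?thesis"
    then have r: "1 \<le> nat (d a)" "nat (d a) \<le> n - 2" "int (nat (d a)) = d a" using n7 by auto
    then have "Y (nat (d a)) = a" using that(1) n7 by (intro d_inj) (auto simp: d_simps)
    then show False using that(2) r n7 by auto
  qed
  have mem: "Y (n - 1) \<in> E" "Y n \<in> E" "Y 1 \<in> E" "Y (n - 2) \<in> E" using n7 by auto
  have W: "w' < 1 \<or> w' > int n - 2" "1 + w' < 1 \<or> 1 + w' > int n - 2" "z' < 1 \<or> z' > int n - 2"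
    using gap[of "Y (n - 1)"] gap[of "Y n"] gap[of Z1] mem d_simps by auto
  have d1: "d (Y 1) = 1" "d (Y (n - 2)) = int n - 2" using n7 d_simps(1)[of 1] d_simps(1)[of "n - 2"] by auto
  have dd: "\<bar>w' - z'\<bar> \<le> int n" "\<bar>1 + w' - z'\<bar> \<le> int n" "\<bar>w' - 1\<bar> \<le> int n" "\<bar>1 + w' - 1\<bar> \<le> int n"
    "\<bar>z' - 1\<bar> \<le> int n" "\<bar>w' - (int n - 2)\<bar> \<le> int n" "\<bar>z' - (int n - 2)\<bar> \<le> int n"
    using d_dist[OF mem(1) in_basis_YZ(2)] d_dist[OF mem(2) in_basis_YZ(2)] d_dist[OF mem(1,3)] d_dist[OF mem(2,3)]
      d_dist[OF in_basis_YZ(2) mem(3)] d_dist[OF mem(1,4)] d_dist[OF in_basis_YZ(2) mem(4)]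
    unfolding d1 d_simps by auto
  have ne: "w' \<noteq> z'" "1 + w' \<noteq> z'"
    using d_inj[OF _ mem(1) in_basis_YZ(2)] d_inj[OF _ mem(2) in_basis_YZ(2)] unfolding d_simps by auto
  have eq: "int m = d e + d f"
    using deg d_simps(1)[OF m(2)] m(1) by (simp add: d_def distrib_left[symmetric])
  have cases: "(\<exists>i. a = Y i \<and> lev a = i \<and> d a = int i \<and> 1 \<le> i \<and> i \<le> n - 2) \<or> a = Y (n - 1) \<and> lev a = 1 \<and> d a = w' \<or>
    a = Y n \<and> lev a = 2 \<and> d a = 1 + w' \<or> a = Z1 \<and> lev a = 1 \<and> d a = z'" if "a \<in> E" for a
    using level_cases[OF that]
  proof (elim disjE exE conjE)
    fix i assume "a = Y i" "1 \<le> i" "i \<le> n - 2" "lev a = i"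
    then show ?thesis using d_simps(1) by blast
  qed (use d_simps in blast)+
  have lv: "int (lev e) + int (lev f) < int m" using lev m(3) by simp
  have ran: "(int (lev a) = d a \<and> 1 \<le> d a \<and> d a \<le> int n - 2) \<or> (int (lev a) = 1 \<and> d a = w') \<or>
      (int (lev a) = 2 \<and> d a = 1 + w') \<or> (int (lev a) = 1 \<and> d a = z')" if "a \<in> E" for a
    using cases[OF that] n7 by auto
  have "int m = int n - 2 \<and> (d e = w' \<and> d f = z' \<or> d e = z' \<and> d f = w')"
    by (rule degree_arith[OF _ _ _ W dd ne eq lv ran[OF E(1)] ran[OF E(2)]]) (use n7 m in auto)
  then have m_eq: "int m = int n - 2" and "d e = w' \<and> d f = z' \<or> d e = z' \<and> d f = w'" by blast+
  moreover have "a = Y (n - 1)" if "a \<in> E" "d a = w'" for a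
    by (rule d_inj[OF _ that(1) mem(1)]) (simp only: that(2) d_simps)
  moreover have "a = Z1" if "a \<in> E" "d a = z'" for a
    by (rule d_inj[OF _ that(1) in_basis_YZ(2)]) (simp only: that(2) d_simps)
  moreover have "m = n - 2" using m_eq by simp
  ultimately show ?thesis using E m(1) by blast
qed

lemma sum_unit_vec: "g \<in> E \<Longrightarrow> (\<Sum>x\<in>E. sc (c * unit_vec_at g x) (B x)) = sc c (B g)"
proof -
  assume g: "g \<in> E"
  have "(\<Sum>x\<in>E. sc (c * unit_vec_at g x) (B x)) = (\<Sum>x\<in>E. if x = g then sc c (B g) else 0)"
    by (rule sum.cong) (auto simp: unit_vec_at_def)
  then show ?thesis using g by simp
qed

lemma WZ_exists:
  assumes n: "n \<noteq> 5" "n \<noteq> 6"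
  shows "\<exists>\<alpha>. br W Z = sc \<alpha> (rpow U (n - 2))" "\<exists>\<beta>. br Z W = sc \<beta> (rpow U (n - 2))"
proof -
  have E: "Y (n - 1) \<in> E" "Z1 \<in> E" using n_ge by auto
  have zero: "\<exists>\<alpha>. 0 = sc \<alpha> (rpow U (n - 2))" by (rule exI[of _ 0]) simp
  show "\<exists>\<alpha>. br W Z = sc \<alpha> (rpow U (n - 2))"
  proof (cases "br W Z = 0")
    case False
    then obtain g c where "g \<in> E" "deg g = deg (Y (n - 1)) + deg Z1" "br W Z = sc c (B g)"
      "lev (Y (n - 1)) + lev Z1 < lev g" using prod_level[OF E(1,2)] by auto
    moreover from this have "g = Y (n - 2)" using deg_level[OF n E(1,2)] by blast
    ultimately show ?thesis by auto
  qed (use zero in simp)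
  show "\<exists>\<alpha>. br Z W = sc \<alpha> (rpow U (n - 2))"
  proof (cases "br Z W = 0")
    case False
    then obtain g c where "g \<in> E" "deg g = deg Z1 + deg (Y (n - 1))" "br Z W = sc c (B g)"
      "lev Z1 + lev (Y (n - 1)) < lev g" using prod_level[OF E(2,1)] by auto
    moreover from this have "g = Y (n - 2)" using deg_level[OF n E(2,1)] by blast
    ultimately show ?thesis by auto
  qed (use zero in simp)
qed

lemma B_prod:
  assumes n: "n \<noteq> 5" "n \<noteq> 6"
    and WZ: "br W Z = sc \<alpha> (rpow U (n - 2))" and ZW: "br Z W = sc \<beta> (rpow U (n - 2))"
    and e: "e \<in> E" and f: "f \<in> E"
  shows "br (B e) (B f) = (\<Sum>g\<in>E. sc (WZ_prod n \<alpha> \<beta> e f g) (B g))"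
proof -
  have mem: "Y (n - 2) \<in> E" "Y n \<in> E" using n_ge by auto
  consider i where "f = Y 1" "e = Y i" "i \<le> n - 3" | "e = Y 1" "f = Y (n - 1)"
    | "e = Y (n - 1)" "f = Z1" | "e = Z1" "f = Y (n - 1)"
    | "\<not> (f = Y 1 \<and> (\<exists>i\<le>n - 3. e = Y i))" "\<not> (e = Y 1 \<and> f = Y (n - 1))"
      "\<not> (e = Y (n - 1) \<and> f = Z1)" "\<not> (e = Z1 \<and> f = Y (n - 1))" by blast
  then show ?thesis
  proof cases
    case 1
    have i: "1 \<le> i" "Y (i + 1) \<in> E" using e 1 n_ge by auto
    have "WZ_prod n \<alpha> \<beta> e f = (\<lambda>g. 1 * unit_vec_at (Y (i + 1)) g)" using 1 i by (simp add: WZ_prod_def)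
    then have "(\<Sum>g\<in>E. sc (WZ_prod n \<alpha> \<beta> e f g) (B g)) = B (Y (i + 1))"
      using sum_unit_vec[OF i(2), of 1] by simp
    moreover have "B e = rpow U i" "B f = U" "B (Y (i + 1)) = br (rpow U i) U"
      using 1 i n_ge by (simp_all add: rpow_Suc)
    ultimately show ?thesis by simp
  next
    case 2
    have "n - 1 \<noteq> 1" using n_ge by simp
    have "WZ_prod n \<alpha> \<beta> e f = (\<lambda>g. 1 * unit_vec_at (Y n) g)"
      using 2 \<open>n - 1 \<noteq> 1\<close> by (simp add: WZ_prod_def)
    then have "(\<Sum>g\<in>E. sc (WZ_prod n \<alpha> \<beta> e f g) (B g)) = B (Y n)"
      using sum_unit_vec[OF mem(2), of 1] by simp
    then show ?thesis using 2 n_ge by simp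
  next
    case 3
    have "WZ_prod n \<alpha> \<beta> e f = (\<lambda>g. \<alpha> * unit_vec_at (Y (n - 2)) g)" using 3 by (simp add: WZ_prod_def)
    then show ?thesis using sum_unit_vec[OF mem(1), of \<alpha>] 3 WZ by simp
  next
    case 4
    have "WZ_prod n \<alpha> \<beta> e f = (\<lambda>g. \<beta> * unit_vec_at (Y (n - 2)) g)" using 4 by (simp add: WZ_prod_def)
    then show ?thesis using sum_unit_vec[OF mem(1), of \<beta>] 4 ZW by simp
  next
    case 5
    \<comment> \<open>Outside the pairs treated so far, a nonzero product would combine degree and
      level in the way that \<open>deg_level\<close> allows only for W and Z.\<close>
    have "br (B e) (B f) = 0"
    proof (rule ccontr)
      assume "br (B e) (B f) \<noteq> 0"
      then obtain g c where "g \<in> E" "deg g = deg e + deg f" "lev e + lev f < lev g"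
        using prod_level[OF e f 5(1,2)] by metis
      then show False using deg_level[OF n e f] 5(3,4) by blast
    qed
    moreover have "WZ_prod n \<alpha> \<beta> e f = (\<lambda>_. 0)"
      using 5 by (cases e; cases f) (simp_all add: WZ_prod_def, blast)
    ultimately show ?thesis by simp
  qed
qed

lemma WZ_prod_outside: "g \<notin> E \<Longrightarrow> WZ_prod n \<alpha> \<beta> e f g = 0"
  using WZ_prod_support[of n \<alpha> \<beta> e f g] n_ge by fastforce

lemma alg_isomorphic_WZ_prod:
  assumes "n \<noteq> 5" "n \<noteq> 6"
    and "br W Z = sc \<alpha> (rpow U (n - 2))" "br Z W = sc \<beta> (rpow U (n - 2))"
  shows "alg_isomorphic (alg_of sc L br) (table_alg E (WZ_prod n \<alpha> \<beta>))"
  by (rule alg_isomorphic_table[OF finite_basis_YZ B_indep B_span WZ_prod_outside B_prod[OF assms]])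

text \<open>Scaling Z preserves homogeneity and adaptedness while multiplying [W,Z] and [Z,W] by the
  same scalar, which permits normalising one of them to U^(n-2).\<close>

lemma rescale_Z:
  assumes "c \<noteq> 0" shows "graded_triple sc L br n ps k h U W (sc c Z) u w z"
proof -
  have "ps 1 (sc c Z) p = c * ps 1 Z p" for p using triple_L by (simp add: ps_scale)
  then show ?thesis
    by unfold_locales
      (use assms dim_L triple_L ps_U ps_W ps_Z homogeneous_gens homogeneous_scale in auto)
qed

text \<open>Without these two products Z annihilates \<open>L\<close> on both sides, and the other
  basis vectors span an ideal \<open>N\<close> with the products of \<open>KF4\<close>. It remains
  to grade both summands with full length.\<close>

lemma standard_if_WZ_zero:
  assumes n: "n \<noteq> 5" "n \<noteq> 6" and WZ: "br W Z = 0" and ZW: "br Z W = 0"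
    and ml: "max_length sc L br"
  shows "standard_algebra sc L br"
proof -
  define I where "I = Y ` {1..n}"
  define N where "N = span (B ` I)"
  have EI: "E = I \<union> {Z1}" "Z1 \<notin> I" by (auto simp: I_def basis_YZ_def)
  have fin: "finite I" by (simp add: I_def)
  have NL: "N \<subseteq> L" unfolding N_def using B_L EI by (intro span_minimal L_subspace) auto
  have prod: "br (B e) (B f) = (\<Sum>g\<in>E. sc (WZ_prod n 0 0 e f g) (B g))" if "e \<in> E" "f \<in> E" for e f
    using B_prod[OF n _ _ that, of 0 0] WZ ZW by simp
  have "WZ_prod n 0 0 e f Z1 = 0" for e f
    by (auto simp: WZ_prod_def unit_vec_at_def split: basis_elt.splits)
  then have term_N: "sc (WZ_prod n 0 0 e f g) (B g) \<in> N" if "g \<in> E" for e f g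
    using that EI unfolding N_def by (cases "g = Z1") (auto simp: span_zero intro!: span_scale intro: span_base)
  have B_N: "br (B e) (B f) \<in> N" if "e \<in> E" "f \<in> E" for e f
    unfolding prod[OF that] using term_N unfolding N_def by (intro span_sum)
  have "WZ_prod n 0 0 e Z1 g = 0" "WZ_prod n 0 0 Z1 e g = 0" for e g
    by (auto simp: WZ_prod_def split: basis_elt.splits)
  then have B_Z: "br (B e) Z = 0" "br Z (B e) = 0" if "e \<in> E" for e
    using prod[OF that in_basis_YZ(2)] prod[OF in_basis_YZ(2) that] by simp_all
  have right: "br x (B f) \<in> N" if "x \<in> L" "f \<in> E" for x f
  proof -
    obtain c where c: "x = (\<Sum>e\<in>E. sc (c e) (B e))" using B_expand \<open>x \<in> L\<close> by blast
    have "br x (B f) = (\<Sum>e\<in>E. br (sc (c e) (B e)) (B f))"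
      unfolding c by (rule br_sum_left) (use B_L that in auto)
    also have "\<dots> = (\<Sum>e\<in>E. sc (c e) (br (B e) (B f)))"
      using B_L that by (intro sum.cong) (auto simp: br_scale_left)
    also have "\<dots> \<in> N" using B_N that unfolding N_def by (intro span_sum span_scale) auto
    finally show ?thesis .
  qed
  have br_N: "br x y \<in> N" if "x \<in> L" "y \<in> L" for x y
  proof -
    obtain c where c: "y = (\<Sum>e\<in>E. sc (c e) (B e))" using B_expand \<open>y \<in> L\<close> by blast
    have "br x y = (\<Sum>e\<in>E. br x (sc (c e) (B e)))"
      unfolding c by (rule br_sum_right) (use B_L that in auto)
    also have "\<dots> = (\<Sum>e\<in>E. sc (c e) (br x (B e)))"
      using B_L that by (intro sum.cong) (auto simp: br_scale_right)
    also have "\<dots> \<in> N" using right that unfolding N_def by (intro span_sum span_scale) auto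
    finally show ?thesis .
  qed
  have br_Z: "br x Z = 0" "br Z x = 0" if "x \<in> L" for x
  proof -
    obtain c where c: "x = (\<Sum>e\<in>E. sc (c e) (B e))" using B_expand \<open>x \<in> L\<close> by blast
    have "br x Z = (\<Sum>e\<in>E. br (sc (c e) (B e)) Z)"
      unfolding c by (rule br_sum_left) (use B_L triple_L in auto)
    also have "\<dots> = 0" using B_L B_Z triple_L by (intro sum.neutral) (auto simp: br_scale_left)
    finally show "br x Z = 0" .
    have "br Z x = (\<Sum>e\<in>E. br Z (sc (c e) (B e)))"
      unfolding c by (rule br_sum_right) (use B_L triple_L in auto)
    also have "\<dots> = 0" using B_L B_Z triple_L by (intro sum.neutral) (auto simp: br_scale_right)
    finally show "br Z x = 0" .
  qed
  have Zspan: "x \<in> span {Z} \<longleftrightarrow> (\<exists>c. x = sc c Z)" for x by (auto simp: span_singleton)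
  have ideal_N: "is_ideal sc L br N"
    unfolding is_ideal_def using br_N NL by (auto simp: N_def)
  have ideal_Z: "is_ideal sc L br (span {Z})"
    unfolding is_ideal_def using br_Z triple_L
    by (auto simp: Zspan br_scale_left br_scale_right intro: exI[of _ 0])
  have ds: "is_direct_sum sc L {1..2::nat} (\<lambda>i. if i = 1 then N else span {Z})"
  proof -
    have "is_direct_sum sc (span (B ` (I \<union> {Z1}))) {1..2::nat}
        (\<lambda>i. if i = 1 then span (B ` I) else span (B ` {Z1}))"
      by (rule direct_sum_two[OF fin]) (use B_indep EI in auto)
    moreover have "B ` {Z1} = {Z}" by simp
    ultimately show ?thesis using B_span unfolding EI(1)[symmetric] N_def by metis
  qed
  have ml_N: "max_length sc N br"
  proof -
    \<comment> \<open>\<open>N\<close> gets its own gradation, with Y_d in degree d for d = 1..n.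
      Both kinds of products respect it: i + 1 is the index of [Y_i,Y_1], and 1 + (n-1) = n that of
      [Y_1,Y_(n-1)].\<close>
    define b where "b d = (if d \<in> {1..1 + int (n - 1)} then B (Y (nat d)) else 0)" for d
    have D: "{1..1 + int (n - 1)} = {1..int n}" using n_ge by auto
    have b: "b d = B (Y (nat d))" if "1 \<le> d" "d \<le> int n" for d using that unfolding b_def D by simp
    have b0: "b d = 0" if "\<not> (1 \<le> d \<and> d \<le> int n)" for d using that unfolding b_def D by auto
    have nat_E: "Y (nat d) \<in> E" if "1 \<le> d" "d \<le> int n" for d using that by auto
    have inj: "inj_on (\<lambda>d. Y (nat d)) {1..1 + int (n - 1)}" by (auto simp: inj_on_def)
    have indep: "family_indep {1..1 + int (n - 1)} b"
      by (rule family_indep_reindex[OF finite_basis_YZ inj _ B_indep]) (unfold D, use nat_E b in auto)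
    have bL: "b d \<in> L" for d using b b0 B_L nat_E by (cases "1 \<le> d \<and> d \<le> int n") auto
    have mult: "\<exists>c. br (b d) (b e) = sc c (b (d + e))" for d e
    proof (cases "(1 \<le> d \<and> d \<le> int n) \<and> 1 \<le> e \<and> e \<le> int n")
      case True
      define i j where "i = nat d" and "j = nat e"
      have ij: "1 \<le> i" "i \<le> n" "1 \<le> j" "j \<le> n" "d = int i" "e = int j"
        using True by (auto simp: i_def j_def)
      have bb: "br (b d) (b e) = (\<Sum>g\<in>E. sc (WZ_prod n 0 0 (Y i) (Y j) g) (B g))"
        using ij b[of d] b[of e] prod[of "Y i" "Y j"] by simp
      consider "j = 1" "i \<le> n - 3" | "i = 1" "j = n - 1"
        | "\<not> (j = 1 \<and> i \<le> n - 3)" "\<not> (i = 1 \<and> j = n - 1)" by blast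
      then show ?thesis
      proof cases
        case 1
        then have "br (b d) (b e) = B (Y (i + 1))"
          using sum_unit_vec[of "Y (i + 1)" 1] ij n_ge unfolding bb by (simp add: WZ_prod_def)
        also have "\<dots> = b (d + e)" using 1 ij n_ge b[of "d + e"] by (simp add: nat_add_distrib)
        finally show ?thesis by (intro exI[of _ 1]) simp
      next
        case 2
        have "n - 1 \<noteq> 1" using n_ge by simp
        then have "br (b d) (b e) = B (Y n)"
          using sum_unit_vec[of "Y n" 1] ij n_ge 2 unfolding bb by (simp add: WZ_prod_def)
        also have "\<dots> = b (d + e)" using 2 ij n_ge b[of "d + e"] by (simp add: of_nat_diff)
        finally show ?thesis by (intro exI[of _ 1]) simp
      next
        case 3
        then have "br (b d) (b e) = 0" unfolding bb by (auto simp: WZ_prod_def)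
        then show ?thesis by (intro exI[of _ 0]) simp
      qed
    next
      case False
      then have "b d = 0 \<or> b e = 0" using b0 by blast
      then have "br (b d) (b e) = 0" using bL by auto
      then show ?thesis by (intro exI[of _ 0]) simp
    qed
    have "b ` {1..1 + int (n - 1)} = B ` I"
    proof -
      have "(\<lambda>d. Y (nat d)) ` {1..int n} = I"
        unfolding I_def by (auto simp: image_iff intro!: bexI[of _ "int _"])
      moreover have "b ` {1..int n} = B ` (\<lambda>d. Y (nat d)) ` {1..int n}"
        unfolding image_image by (rule image_cong) (use b in auto)
      ultimately show ?thesis by (simp only: D)
    qed
    then have spn: "N = span (b ` {1..1 + int (n - 1)})" by (simp add: N_def)
    have "dim N = card (b ` {1..1 + int (n - 1)})"
      unfolding spn by (rule dim_span_eq_card_independent, rule family_indep_imp_independent[OF _ indep]) simp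
    also have "\<dots> = n" using card_image[OF family_indep_inj[OF _ indep]] n_ge by (simp add: of_nat_diff)
    finally have dim: "n - 1 + 1 = dim N" using n_ge by simp
    have "connected_gradation sc N br 1 (n - 1) (\<lambda>d. span {b d})"
      unfolding spn by (rule family_gradation[OF _ indep bL mult]) (unfold b_def, rule if_not_P)
    from max_lengthI[OF _ spn this dim] show ?thesis by simp
  qed
  have ml_Z: "max_length sc (span {Z}) br"
  proof -
    define b where "b d = (if d = 1 then Z else 0)" for d :: int
    have Z0: "Z \<noteq> 0" using B_nonzero[of Z1] by simp
    have indep: "family_indep {1..1 + int 0} b" using Z0 by (auto simp: family_indep_def b_def)
    have spn: "span {Z} = span (b ` {1..1 + int 0})" by (simp add: b_def)
    have "br (b d) (b e) = 0" for d e using br_Z triple_L by (simp add: b_def)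
    then have mult: "\<exists>c. br (b d) (b e) = sc c (b (d + e))" for d e by (intro exI[of _ 0]) simp
    have "connected_gradation sc (span {Z}) br 1 0 (\<lambda>d. span {b d})"
      unfolding spn by (rule family_gradation[OF _ indep _ mult]) (use triple_L in \<open>auto simp: b_def\<close>)
    moreover have "0 + 1 = dim (span {Z})"
      using dim_span_eq_card_independent[of "{Z}"] Z0 by simp
    ultimately show ?thesis using max_lengthI[of "{Z}" "span {Z}"] by simp
  qed
  have "Y 1 \<in> I" using n_ge by (simp add: I_def)
  then have "B (Y 1) \<in> N" "B (Y 1) \<noteq> 0"
    using EI(1) B_nonzero[of "Y 1"] by (auto simp only: N_def intro: span_base)
  then have "N \<noteq> {0}" by blast
  moreover have "span {Z} \<noteq> {0}" using B_nonzero[of Z1] span_base[of Z "{Z}"] by auto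
  ultimately show ?thesis
    unfolding standard_algebra_def
    using ml ds ideal_N ideal_Z ml_N ml_Z
    by (intro conjI exI[of _ "2::nat"] exI[of _ "\<lambda>i. if i = 1 then N else span {Z}"]) auto
qed

text \<open>If [W,Z] is nonzero it is normalised to U^(n-2), and the parameter of M^{1,\<alpha>} is
  the ratio of the two scalars. If only [Z,W] is nonzero the result is M, and if both vanish the
  algebra splits.\<close>

lemma non_standard_isomorphic:
  assumes n: "n \<noteq> 5" "n \<noteq> 6" and ns: "non_standard_algebra sc L br"
  shows "alg_isomorphic (alg_of sc L br) (M_alg n) \<or>
    (\<exists>\<alpha>. alg_isomorphic (alg_of sc L br) (M1_alg n \<alpha>))"
proof -
  obtain \<alpha> \<beta> where WZ: "br W Z = sc \<alpha> (rpow U (n - 2))" and ZW: "br Z W = sc \<beta> (rpow U (n - 2))"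
    using WZ_exists[OF n] by blast
  have scaled: "br W (sc c Z) = sc (c * \<alpha>) (rpow U (n - 2))" "br (sc c Z) W = sc (c * \<beta>) (rpow U (n - 2))" for c
    using triple_L WZ ZW by (simp_all add: br_scale_left br_scale_right)
  have iso: "alg_isomorphic (alg_of sc L br) (table_alg E (WZ_prod n (c * \<alpha>) (c * \<beta>)))" if "c \<noteq> 0" for c
    by (rule graded_triple.alg_isomorphic_WZ_prod[OF rescale_Z[OF that] n scaled])
  consider "\<alpha> \<noteq> 0" | "\<alpha> = 0" "\<beta> \<noteq> 0" | "\<alpha> = 0" "\<beta> = 0" by blast
  then show ?thesis
  proof cases
    case 1
    then show ?thesis using iso[of "1 / \<alpha>"] M1_alg_eq by force
  next
    case 2
    then show ?thesis using iso[of "1 / \<beta>"] M_alg_eq by simp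
  next
    case 3
    then have "standard_algebra sc L br"
      using standard_if_WZ_zero[OF n] WZ ZW ns by (simp add: non_standard_algebra_def)
    then show ?thesis using ns by (simp add: non_standard_algebra_def)
  qed
qed

end

section \<open>The classification\<close>

theorem theorem2p4:
  fixes sc :: "complex \<Rightarrow> 'a::ab_group_add \<Rightarrow> 'a"
    and L :: "'a set"
    and br :: "'a \<Rightarrow> 'a \<Rightarrow> 'a"
    and n :: nat
  assumes "n \<ge> 4" and "n \<noteq> 5" and "n \<noteq> 6"
    and "leibniz_algebra sc L br"
    and "vector_space.dim sc L = n + 1"
    and "three_filiform sc L br"
    and "\<not> lie_algebra sc L br"
    and "max_length sc L br"
    and "non_standard_algebra sc L br"
    and "alg_isomorphic (gr_alg sc L br) (alg_direct_sum (KF4 n) zero_line)"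
  shows "alg_isomorphic (alg_of sc L br) (M_alg n) \<or>
    (\<exists>\<alpha>::complex. alg_isomorphic (alg_of sc L br) (M1_alg n \<alpha>))"
proof -
  have "vector_space sc" using assms(4) by (simp add: leibniz_algebra_def fd_algebra_def)
  then interpret leib sc L br
    using assms(4) by (intro leib.intro complex_vector_space.intro leib_axioms.intro)
  obtain ps where "gr_KF4 sc L br n ps" using gr_KF4_exists[OF assms(10,1)] by blast
  then interpret gr_KF4 sc L br n ps .
  obtain k h where h: "\<And>d. d \<notin> {k..k + int n} \<Longrightarrow> h d = 0" "family_indep {k..k + int n} h"
    "\<And>d. h d \<in> L" "\<And>d e. \<exists>c. br (h d) (h e) = sc c (h (d + e))"
    using homogeneous_basis[OF assms(8,5)] by blast
  interpret graded_KF4 sc L br n ps k h by unfold_locales (use h assms(5) in auto)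
  obtain u w z where "adapted_triple sc L br n ps (h u) (h w) (h z)" by (rule homogeneous_triple)
  then interpret adapted_triple sc L br n ps "h u" "h w" "h z" .
  interpret graded_triple sc L br n ps k h "h u" "h w" "h z" u w z
    by unfold_locales simp_all
  show ?thesis by (rule non_standard_isomorphic[OF assms(2,3,9)])
qed

end
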